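(* Assume $2^{\aleph_0}=\aleph_1$. There exists a Banach space $V$ of density $\aleph_1$ such that every Banach space of density $\leq\aleph_1$ is linearly isometric to a subspace of $V$, and every linear isometry $T\colon X\to Y$ between separable subspaces $X,Y$ of $V$ can be extended to a linear isometry of $V$. Moreover, the space $V$ is unique, up to a linear isometry.
   Context: The density of a Banach space is the minimal cardinality of a dense subset. Subspaces are closed linear subspaces. A linear isometry $T\colon X\to Y$ between subspaces, as well as a linear isometry "of $V$" (i.e. $V\to V$), is understood to be a bijective norm-preserving linear map. Uniqueness means: any two Banach spaces with the stated properties are linearly isometric. *)

theory Defs
  imports "HOL-Analysis.Analysis" "HOL-Algebra.Module"
begin

unbundle cardinal_syntax

text \<open>
  Banach spaces are carrier-based structures rather than types of class \<open>banach\<close>, so that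
  existence of a space and quantification over all spaces can be stated inside a formula.
  They are modules, in the sense of \<open>HOL-Algebra\<close>, over the field of real numbers, together with
  a norm. The ring multiplication and unit that the record \<open>module\<close> inherits are never used.
\<close>

definition real_ring :: "real ring" where
  "real_ring = \<lparr>carrier = UNIV, mult = (*), one = 1, zero = 0, add = (+)\<rparr>"

record 'a normed_space = "(real, 'a) module" +
  nrm :: "'a \<Rightarrow> real"

locale normed_space = module real_ring V for V :: "'a normed_space" (structure) +
  assumes nrm_eq_0_iff: "x \<in> carrier V \<Longrightarrow> nrm V x = 0 \<longleftrightarrow> x = \<zero>"
    and nrm_triangle: "x \<in> carrier V \<Longrightarrow> y \<in> carrier V \<Longrightarrow> nrm V (x \<oplus> y) \<le> nrm V x + nrm V y"
    and nrm_smult: "x \<in> carrier V \<Longrightarrow> nrm V (a \<odot> x) = \<bar>a\<bar> * nrm V x"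

text \<open>
  The library's type of metrics requires a distance that is nonnegative and symmetric on
  the whole type, whereas \<open>nrm V\<close> is arbitrary outside the carrier; hence the cut-off.
\<close>

definition norm_metric :: "'a normed_space \<Rightarrow> 'a metric" where
  "norm_metric V = metric (carrier V,
     \<lambda>x y. if x \<in> carrier V \<and> y \<in> carrier V then nrm V (x \<ominus>\<^bsub>V\<^esub> y) else 0)"

abbreviation norm_topology :: "'a normed_space \<Rightarrow> 'a topology" where
  "norm_topology V \<equiv> mtopology_of (norm_metric V)"

locale banach_space = normed_space +
  assumes complete: "mcomplete_of (norm_metric V)"

text \<open>
  The density is the least cardinality of a dense subset; as usual for cardinals in HOL, it is
  a well-order of minimal type, to be compared by \<open>\<le>o\<close> and \<open>=o\<close> only.
\<close>

definition dense_subset :: "'a set \<Rightarrow> 'a normed_space \<Rightarrow> bool" where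
  "dense_subset D V \<longleftrightarrow> D \<subseteq> carrier V \<and> norm_topology V closure_of D = carrier V"

definition density :: "'a normed_space \<Rightarrow> 'a rel" where
  "density V = card_of (SOME D. dense_subset D V \<and> (\<forall>E. dense_subset E V \<longrightarrow> |D| \<le>o |E| ))"

abbreviation aleph1 :: "nat set rel" where
  "aleph1 \<equiv> cardSuc natLeq"

abbreviation subspace_of :: "'a set \<Rightarrow> 'a normed_space \<Rightarrow> 'a normed_space" where
  "subspace_of S V \<equiv> V\<lparr>carrier := S\<rparr>"

definition closed_subspace :: "'a set \<Rightarrow> 'a normed_space \<Rightarrow> bool" where
  "closed_subspace S V \<longleftrightarrow> submodule S real_ring V \<and> closedin (norm_topology V) S"

definition linear_isometry :: "'a normed_space \<Rightarrow> 'b normed_space \<Rightarrow> ('a \<Rightarrow> 'b) \<Rightarrow> bool" where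
  "linear_isometry X Y T \<longleftrightarrow>
     bij_betw T (carrier X) (carrier Y) \<and>
     (\<forall>x\<in>carrier X. \<forall>y\<in>carrier X. T (x \<oplus>\<^bsub>X\<^esub> y) = T x \<oplus>\<^bsub>Y\<^esub> T y) \<and>
     (\<forall>a. \<forall>x\<in>carrier X. T (a \<odot>\<^bsub>X\<^esub> x) = a \<odot>\<^bsub>Y\<^esub> T x) \<and>
     (\<forall>x\<in>carrier X. nrm Y (T x) = nrm X x)"

definition linearly_isometric :: "'a normed_space \<Rightarrow> 'b normed_space \<Rightarrow> bool" where
  "linearly_isometric X Y \<longleftrightarrow> (\<exists>T. linear_isometry X Y T)"

definition isometric_to_subspace :: "'a normed_space \<Rightarrow> 'b normed_space \<Rightarrow> bool" where
  "isometric_to_subspace X V \<longleftrightarrow>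
     (\<exists>S. closed_subspace S V \<and> linearly_isometric X (subspace_of S V))"

text \<open>
  The type argument is the type that carries the spaces \<open>X\<close> to be embedded, since a formula cannot
  quantify over types.
\<close>

definition universal_aleph1 :: "'x itself \<Rightarrow> 'v normed_space \<Rightarrow> bool" where
  "universal_aleph1 _ V \<longleftrightarrow>
     (\<forall>X :: 'x normed_space. banach_space X \<and> density X \<le>o aleph1 \<longrightarrow> isometric_to_subspace X V)"

definition extends_separable_isometries :: "'v normed_space \<Rightarrow> bool" where
  "extends_separable_isometries V \<longleftrightarrow>
     (\<forall>X Y T. closed_subspace X V \<and> separable_space (norm_topology (subspace_of X V)) \<and>
              closed_subspace Y V \<and> separable_space (norm_topology (subspace_of Y V)) \<and>
              linear_isometry (subspace_of X V) (subspace_of Y V) T \<longrightarrow>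
        (\<exists>F. linear_isometry V V F \<and> (\<forall>x\<in>X. F x = T x)))"

text \<open>
  Assuming CH, a Banach space of density at most \<open>aleph1\<close> has at most continuum many points, so it is
  linearly isometric to one carried by a set of reals. Testing universality on spaces of type
  \<open>real normed_space\<close> therefore loses nothing.
\<close>

definition universal_homogeneous :: "'v normed_space \<Rightarrow> bool" where
  "universal_homogeneous V \<longleftrightarrow>
     banach_space V \<and> density V =o aleph1 \<and>
     universal_aleph1 TYPE(real) V \<and> extends_separable_isometries V"


lemma cring_real_ring: "cring real_ring"
proof (rule cringI)
  show "abelian_group real_ring"
    by (rule abelian_groupI) (auto simp: real_ring_def intro: exI[of _ "- _ :: real"])
  show "comm_monoid real_ring"
    by (rule comm_monoidI) (auto simp: real_ring_def)
qed (auto simp: real_ring_def algebra_simps)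

context normed_space
begin

lemma nrm_nonneg: "x \<in> carrier V \<Longrightarrow> 0 \<le> nrm V x"
proof -
  assume x: "x \<in> carrier V"
  have m1: "(- 1) \<odot> x \<in> carrier V"
    using x by (intro smult_closed) (auto simp: real_ring_def)
  have "nrm V ((- 1) \<odot> x) = nrm V x" using nrm_smult[OF x, of "-1"] by simp
  moreover have "x \<oplus> (- 1) \<odot> x = \<zero>"
    using smult_l_distr[of 1 "-1" x] smult_one[OF x] smult_l_null[OF x] x
    by (simp add: real_ring_def)
  moreover have "nrm V \<zero> = 0" using nrm_eq_0_iff by blast
  ultimately show ?thesis using nrm_triangle[OF x m1] by simp
qed

lemma nrm_minus: "x \<in> carrier V \<Longrightarrow> nrm V (\<ominus> x) = nrm V x"
proof -
  assume x: "x \<in> carrier V"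
  have "\<ominus>\<^bsub>real_ring\<^esub> (1::real) = - 1"
    by (rule cring.sum_zero_eq_neg[OF cring_real_ring, symmetric]) (auto simp: real_ring_def)
  then have "\<ominus> x = (- 1) \<odot> x"
    using smult_l_minus[of 1 x] smult_one[OF x] x by (simp add: real_ring_def)
  then show ?thesis using nrm_smult[OF x, of "-1"] by simp
qed

lemma Metric_space_norm:
  "Metric_space (carrier V)
     (\<lambda>x y. if x \<in> carrier V \<and> y \<in> carrier V then nrm V (x \<ominus> y) else 0)"
proof
  fix x y z
  show "0 \<le> (if x \<in> carrier V \<and> y \<in> carrier V then nrm V (x \<ominus> y) else 0)"
    by (simp add: nrm_nonneg)
  show "(if x \<in> carrier V \<and> y \<in> carrier V then nrm V (x \<ominus> y) else 0) =
        (if y \<in> carrier V \<and> x \<in> carrier V then nrm V (y \<ominus> x) else 0)"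
  proof (cases "x \<in> carrier V \<and> y \<in> carrier V")
    case True
    then have "\<ominus> (x \<ominus> y) = y \<ominus> x"
      by (simp add: a_minus_def M.minus_add M.a_comm)
    then show ?thesis using nrm_minus[of "x \<ominus> y"] True by simp
  qed auto
  assume x: "x \<in> carrier V" and y: "y \<in> carrier V"
  then show "((if x \<in> carrier V \<and> y \<in> carrier V then nrm V (x \<ominus> y) else 0) = 0) = (x = y)"
    using nrm_eq_0_iff[of "x \<ominus> y"] M.minus_equality[of x "\<ominus> y"] M.minus_minus M.r_neg
    by (auto simp: a_minus_def)
  assume z: "z \<in> carrier V"
  have "x \<ominus> z = (x \<ominus> y) \<oplus> (y \<ominus> z)"
    using x y z by (simp add: a_minus_def M.a_assoc M.r_neg2 M.r_neg1)
  then show "(if x \<in> carrier V \<and> z \<in> carrier V then nrm V (x \<ominus> z) else 0) \<le>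
     (if x \<in> carrier V \<and> y \<in> carrier V then nrm V (x \<ominus> y) else 0) +
     (if y \<in> carrier V \<and> z \<in> carrier V then nrm V (y \<ominus> z) else 0)"
    using x y z nrm_triangle[of "x \<ominus> y" "y \<ominus> z"] by simp
qed

lemma mspace_norm_metric [simp]: "mspace (norm_metric V) = carrier V"
  unfolding norm_metric_def by (rule Metric_space.mspace_metric[OF Metric_space_norm])

lemma mdist_norm_metric:
  "x \<in> carrier V \<Longrightarrow> y \<in> carrier V \<Longrightarrow> mdist (norm_metric V) x y = nrm V (x \<ominus> y)"
  unfolding norm_metric_def by (simp add: Metric_space.mdist_metric[OF Metric_space_norm])

lemma density_attained: "\<exists>D. dense_subset D V \<and> density V = |D|"
  and density_le: "dense_subset E V \<Longrightarrow> density V \<le>o |E|"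
proof -
  let ?R = "{|D| | D. dense_subset D V}"
  let ?P = "\<lambda>D. dense_subset D V \<and> (\<forall>E. dense_subset E V \<longrightarrow> |D| \<le>o |E| )"
  have "norm_topology V closure_of carrier V = carrier V"
    using closure_of_topspace[of "norm_topology V"] by simp
  then have "dense_subset (carrier V) V" by (simp add: dense_subset_def)
  then have "?R \<noteq> {}" by blast
  moreover have "\<forall>r\<in>?R. Card_order r" by (auto simp: card_of_Card_order)
  ultimately have "\<exists>r\<in>?R. \<forall>r'\<in>?R. r \<le>o r'"
    using exists_minim_Card_order[of ?R] by blast
  then have "\<exists>D. ?P D" by blast
  then have "?P (SOME D. ?P D)" by (rule someI_ex)
  then show "\<exists>D. dense_subset D V \<and> density V = |D|"
    and "dense_subset E V \<Longrightarrow> density V \<le>o |E|"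
    unfolding density_def by blast+
qed

end

end

theory Submission
  imports Defs "HOL-Library.Countable_Set_Type" "HOL-Library.Poly_Mapping"
begin

text \<open>
  The space is the Fraisse-Jonsson limit of the separable Banach spaces, and all its properties follow
  from one: whenever a separable subspace is enlarged by one point, the enlargement embeds into the
  space over the subspace. Uniqueness and homogeneity are then back-and-forth arguments of length
  \<open>\<omega>\<^sub>1\<close>, universality is the forth half of them, and completeness and nonseparability come from applying
  the property to suitable one-point extensions.

  Most of the proof does not speak about normed spaces with a carrier but about seminorms on real vector
  spaces of a type class. A Banach space of density at most \<open>\<aleph>\<^sub>1\<close> has at most continuum many points,
  so it is the quotient by the null vectors of a seminorm on the free real vector space over the reals
  (\<open>presented_by_free_space\<close>), and conversely each such seminorm has a quotient that is carried by reals
  (\<open>exists_presented\<close>). The extension property becomes the notion \<open>one_point_saturated\<close>, which mentions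
  only the distances from the new point to countably many points; in this form it needs no subspaces and
  no completions.

  The continuum hypothesis is used through \<open>generic_chain\<close>: a chain in a countably closed poset can meet
  continuum many dense sets. Applied to seminorms on countable sets of coordinates, it gives a saturated
  seminorm (\<open>exists_one_point_saturated\<close>); applied to separable partial isometries, it gives
  \<open>universality_by_forth\<close> and \<open>back_and_forth\<close>. Their single step, \<open>one_point_extension\<close>, rests on
  amalgamation of seminorms (\<open>amalgam_seminorm\<close>).

  Consequently a saturated seminorm presents a universal homogeneous space, and any two spaces presented
  by saturated seminorms are linearly isometric. It remains to see that every universal homogeneous space
  is presented by a saturated seminorm (\<open>universal_homogeneous_saturated\<close>): a one-point extension of a
  separable subspace first embeds somewhere, by universality, and is then moved into place by an
  automorphism, by homogeneity.
\<close>

section \<open>Generic chains under the continuum hypothesis\<close>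

lemma card_real_eq_aleph1:
  assumes CH: "ctwo ^c natLeq =o cardSuc natLeq"
  shows "|UNIV :: real set| =o cardSuc natLeq"
proof -
  have "ctwo ^c natLeq = |Func (UNIV :: nat set) (UNIV :: bool set)|"
    by (simp add: cexp_def ctwo_def Field_card_of Field_natLeq)
  moreover have "|Pow (UNIV :: nat set)| =o |Func (UNIV :: nat set) (UNIV :: bool set)|"
    by (rule card_of_Pow_Func)
  ultimately have "ctwo ^c natLeq =o |UNIV :: nat set set|"
    by (metis Pow_UNIV ordIso_symmetric)
  moreover have "|UNIV :: nat set set| =o |UNIV :: real set|"
    using nat_sets_eqpoll_reals by (metis card_of_ordIso eqpoll_def)
  ultimately show ?thesis
    using CH by (meson ordIso_symmetric ordIso_transitive)
qed

text \<open>
  A well-order of the reals of minimal order type; by the continuum hypothesis its proper initial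
  segments are countable.
\<close>

lemma CH_wellorder_real:
  assumes CH: "ctwo ^c natLeq =o cardSuc natLeq"
  obtains r :: "real rel" where "wf r" "total r" "\<And>x. countable {y. (y, x) \<in> r}"
proof -
  let ?r = "card_of (UNIV :: real set)"
  note r = card_real_eq_aleph1[OF CH]
  have wo: "Well_order ?r" by (rule card_of_Well_order)
  show ?thesis
  proof (rule that[of "?r - Id"])
    show "wf (?r - Id)" using wo by (simp add: well_order_on_def)
    show "total (?r - Id)"
      using wo by (simp add: well_order_on_def linear_order_on_def Field_card_of total_on_diff_Id)
    fix x :: real
    have "|underS ?r x| <o ?r"
      by (rule card_of_underS) (auto simp: card_of_card_order_on Field_card_of)
    then have "|underS ?r x| <o cardSuc natLeq"
      using r ordLess_ordIso_trans by blast
    then have "|underS ?r x| \<le>o natLeq"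
      by (simp add: cardSuc_ordLess_ordLeq card_of_Card_order natLeq_Card_order
          cardSuc_ordLeq_ordLess card_of_card_order_on)
    then have "countable (underS ?r x)"
      by (metis countable_card_le_natLeq)
    then show "countable {y. (y, x) \<in> ?r - Id}"
      by (rule countable_subset[rotated]) (auto simp: underS_def)
  qed
qed

text \<open>
  Every transfinite construction below is an instance of this lemma: a poset in which countable
  chains are bounded has, for any family of at most continuum many dense sets, a chain that meets
  all of them. Under the continuum hypothesis the requirements can be well-ordered with countable
  initial segments, so at each stage the choices made so far are a countable chain; bound it and
  then enter the next dense set.
\<close>

lemma generic_chain:
  fixes P :: "'p \<Rightarrow> bool" and le :: "'p \<Rightarrow> 'p \<Rightarrow> bool" and D :: "'i \<Rightarrow> 'p set"
  assumes CH: "ctwo ^c natLeq =o cardSuc natLeq"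
    and I: "(UNIV :: 'i set) \<lesssim> (UNIV :: real set)"
    and refl: "\<And>p. P p \<Longrightarrow> le p p"
    and trans: "\<And>p q s. le p q \<Longrightarrow> le q s \<Longrightarrow> le p s"
    and closed: "\<And>C. countable C \<Longrightarrow> (\<And>p. p \<in> C \<Longrightarrow> P p) \<Longrightarrow>
        (\<And>p q. p \<in> C \<Longrightarrow> q \<in> C \<Longrightarrow> le p q \<or> le q p) \<Longrightarrow> \<exists>u. P u \<and> (\<forall>p\<in>C. le p u)"
    and dense: "\<And>p i. P p \<Longrightarrow> \<exists>q. P q \<and> le p q \<and> q \<in> D i"
  shows "\<exists>f. (\<forall>i. P (f i) \<and> f i \<in> D i) \<and> (\<forall>i j. le (f i) (f j) \<or> le (f j) (f i))"
proof -
  obtain r :: "real rel" where r: "wf r" "total r" "\<And>x. countable {y. (y, x) \<in> r}"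
    by (rule CH_wellorder_real[OF CH]) blast
  obtain h :: "'i \<Rightarrow> real" where h: "inj h"
    using I by (auto simp: lepoll_def)
  define R where "R = inv_image r h"
  have "wf R" using r(1) by (simp add: R_def)
  have "\<exists>f. \<forall>i. P (f i) \<and> f i \<in> D i \<and> (\<forall>j. (j, i) \<in> R \<longrightarrow> le (f j) (f i))"
  proof (rule dependent_wf_choice[OF \<open>wf R\<close>, where P = "\<lambda>f i q. P q \<and> q \<in> D i \<and> (\<forall>j. (j, i) \<in> R \<longrightarrow> le (f j) q)"])
    fix i f
    assume IH: "\<And>j. (j, i) \<in> R \<Longrightarrow>
      P (f j) \<and> f j \<in> D j \<and> (\<forall>k. (k, j) \<in> R \<longrightarrow> le (f k) (f j))"
    let ?C = "f ` {j. (j, i) \<in> R}"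
    have "countable {j. (j, i) \<in> R}"
    proof (rule countable_image_inj_on)
      show "countable (h ` {j. (j, i) \<in> R})"
        by (rule countable_subset[OF _ r(3)[of "h i"]]) (auto simp: R_def)
      show "inj_on h {j. (j, i) \<in> R}" using h inj_on_subset by blast
    qed
    then have "countable ?C" by simp
    moreover have "le p q \<or> le q p" if pq: "p \<in> ?C" "q \<in> ?C" for p q
    proof -
      obtain j k where jk: "p = f j" "q = f k" "(j, i) \<in> R" "(k, i) \<in> R"
        using pq by auto
      have "j = k \<or> (j, k) \<in> R \<or> (k, j) \<in> R"
        using r(2) h by (auto simp: R_def total_on_def dest: injD)
      then show ?thesis using IH jk refl by blast
    qed
    ultimately obtain u where u: "P u" "\<forall>p\<in>?C. le p u"
      using closed[of ?C] IH by blast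
    obtain q where "P q" "le u q" "q \<in> D i" using dense[OF u(1)] by blast
    then show "\<exists>q. P q \<and> q \<in> D i \<and> (\<forall>j. (j, i) \<in> R \<longrightarrow> le (f j) q)"
      using u(2) trans by blast
  qed auto
  then obtain f where f: "\<And>i. P (f i)" "\<And>i. f i \<in> D i" "\<And>i j. (j, i) \<in> R \<Longrightarrow> le (f j) (f i)"
    by blast
  moreover have "le (f i) (f j) \<or> le (f j) (f i)" for i j
  proof -
    have "i = j \<or> (i, j) \<in> R \<or> (j, i) \<in> R"
      using r(2) h by (auto simp: R_def total_on_def dest: injD)
    then show ?thesis using f refl by blast
  qed
  ultimately show ?thesis by blast
qed

section \<open>Seminorms, one-point saturation and partial isometries\<close>

definition seminorm :: "('a::real_vector \<Rightarrow> real) \<Rightarrow> bool" where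
  "seminorm N \<longleftrightarrow> (\<forall>x y. N (x + y) \<le> N x + N y) \<and> (\<forall>a x. N (a *\<^sub>R x) = \<bar>a\<bar> * N x)"

lemma seminormI:
  "(\<And>x y. N (x + y) \<le> N x + N y) \<Longrightarrow> (\<And>a x. N (a *\<^sub>R x) = \<bar>a\<bar> * N x) \<Longrightarrow> seminorm N"
  by (simp add: seminorm_def)

text \<open>
  One inequality is enough for homogeneity, as it also applies to the inverse scalar.
\<close>

lemma seminorm_le_scaleI:
  assumes "\<And>x y. N (x + y) \<le> N x + N y" "N 0 = 0" "\<And>a x. a \<noteq> 0 \<Longrightarrow> N (a *\<^sub>R x) \<le> \<bar>a\<bar> * N x"
  shows "seminorm N"
proof (rule seminormI)
  fix a :: real and x
  show "N (a *\<^sub>R x) = \<bar>a\<bar> * N x"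
  proof (cases "a = 0")
    case False
    have "\<bar>a\<bar> * N (inverse a *\<^sub>R (a *\<^sub>R x)) \<le> \<bar>a\<bar> * (\<bar>inverse a\<bar> * N (a *\<^sub>R x))"
      by (intro mult_left_mono assms(3)) (use False in auto)
    then have "\<bar>a\<bar> * N x \<le> N (a *\<^sub>R x)" using False by (simp add: field_simps)
    then show ?thesis using assms(3)[OF False, of x] by simp
  qed (simp add: assms(2))
qed (fact assms(1))

context
  fixes N :: "'a::real_vector \<Rightarrow> real"
  assumes N: "seminorm N"
begin

lemma seminorm_triangle: "N (x + y) \<le> N x + N y"
  and seminorm_scale: "N (a *\<^sub>R x) = \<bar>a\<bar> * N x"
  using N by (auto simp: seminorm_def)

lemma seminorm_zero: "N 0 = 0"
  using seminorm_scale[of 0 0] by simp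

lemma seminorm_uminus: "N (- x) = N x"
  using seminorm_scale[of "-1" x] by simp

lemma seminorm_minus_commute: "N (x - y) = N (y - x)"
  using seminorm_uminus[of "x - y"] by simp

lemma seminorm_diff: "N (x - y) \<le> N x + N y"
  using seminorm_triangle[of x "- y"] seminorm_uminus[of y] by simp

lemma seminorm_triangle_sub: "N x \<le> N y + N (x - y)"
  using seminorm_triangle[of y "x - y"] by simp

lemma seminorm_nonneg: "0 \<le> N x"
  using seminorm_diff[of x x] seminorm_zero by simp

lemma seminorm_dist_triangle: "N (x - z) \<le> N (x - y) + N (y - z)"
  using seminorm_triangle[of "x - y" "y - z"] by simp

end

text \<open>
  The space \<open>'a \<times> real\<close> stands for a one-point extension \<open>'a + \<real>e\<close>, with \<open>(y, t)\<close> for \<open>y + t e\<close>.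
  Saturation says that every seminorm extending \<open>N\<close> to such an extension can be realized inside
  \<open>'a\<close>, as far as countably many of the values \<open>M (x + e)\<close> are concerned. As \<open>M\<close> is only a seminorm,
  \<open>e\<close> may be a limit of points of \<open>'a\<close>, so completeness is a case of saturation.
\<close>

definition one_point_saturated :: "('a::real_vector \<Rightarrow> real) \<Rightarrow> bool" where
  "one_point_saturated N \<longleftrightarrow>
     (\<forall>(x :: nat \<Rightarrow> 'a) M. seminorm M \<and> (\<forall>y. M (y, 0) = N y) \<longrightarrow>
        (\<exists>v. \<forall>n. N (x n + v) = M (x n, 1 :: real)))"

definition separably_dense :: "('a::real_vector \<Rightarrow> real) \<Rightarrow> 'a set \<Rightarrow> 'a set \<Rightarrow> bool" where
  "separably_dense N Q S \<longleftrightarrow> countable Q \<and> Q \<subseteq> S \<and> (\<forall>x\<in>S. \<forall>e>0. \<exists>q\<in>Q. N (x - q) < e)"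

lemma scaleR_approx:
  assumes N: "seminorm N" and e: "0 < e"
  obtains q where "q \<in> \<rat>" "N (t *\<^sub>R x - q *\<^sub>R x) < e"
proof -
  have "0 < e / (N x + 1)" using e seminorm_nonneg[OF N, of x] by simp
  then obtain q where q: "q \<in> \<rat>" "t - e / (N x + 1) < q" "q < t"
    using Rats_dense_in_real[of "t - e / (N x + 1)" t] by auto
  have "N (t *\<^sub>R x - q *\<^sub>R x) = \<bar>t - q\<bar> * N x"
    by (metis seminorm_scale[OF N] scaleR_left_diff_distrib)
  also have "\<dots> \<le> \<bar>t - q\<bar> * (N x + 1)" by (intro mult_left_mono) auto
  also have "\<dots> < e"
    using q seminorm_nonneg[OF N, of x] by (simp add: field_simps)
  finally show ?thesis using that q(1) by blast
qed

text \<open>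
  Rational linear combinations are dense in the span; they are indexed by lists of pairs of a
  rational coefficient and an index.
\<close>

lemma countable_span_separable:
  fixes x :: "nat \<Rightarrow> 'a::real_vector"
  assumes N: "seminorm N"
  obtains Q where "separably_dense N Q (span (range x))"
proof -
  define c where "c l = sum_list (map (\<lambda>(r, n). real_of_rat r *\<^sub>R x n) l)" for l
  have c_in: "c l \<in> span (range x)" for l
    unfolding c_def by (induction l) (auto intro: span_zero intro!: span_add[OF span_scale[OF span_base]])
  have dense: "\<forall>e>0. \<exists>l. N (y - c l) < e" if "y \<in> span (range x)" for y
    using that
  proof (induction rule: span_induct_alt)
    case base
    have "N (0 - c []) = 0" by (simp add: c_def seminorm_zero[OF N])
    then show ?case by (metis)
  next
    case (step t z y)
    then obtain n where n: "z = x n" by auto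
    show ?case
    proof (intro allI impI)
      fix e :: real assume e: "e > 0"
      obtain l where l: "N (y - c l) < e / 2" using step e by (meson half_gt_zero)
      obtain q where q: "q \<in> \<rat>" "N (t *\<^sub>R z - q *\<^sub>R z) < e / 2"
        using scaleR_approx[OF N, of "e / 2"] e by (metis half_gt_zero)
      obtain r where r: "q = real_of_rat r" using q(1) by (auto elim: Rats_cases)
      have "c ((r, n) # l) = q *\<^sub>R z + c l" by (simp add: c_def n r)
      then have eq: "t *\<^sub>R z + y - c ((r, n) # l) = (t *\<^sub>R z - q *\<^sub>R z) + (y - c l)" by simp
      have "N (t *\<^sub>R z + y - c ((r, n) # l)) < e"
        unfolding eq using seminorm_triangle[OF N, of "t *\<^sub>R z - q *\<^sub>R z" "y - c l"] l q(2) by simp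
      then show "\<exists>l. N (t *\<^sub>R z + y - c l) < e" by blast
    qed
  qed
  have "separably_dense N (range c) (span (range x))"
    unfolding separably_dense_def
  proof (intro conjI)
    show "countable (range c)" by simp
  qed (use c_in dense in auto)
  then show ?thesis using that by blast
qed

text \<open>
  A partial isometry is given by its graph, a linear subspace of the product. As \<open>N\<close> and \<open>M\<close> may
  vanish on nonzero vectors, the graph is a function only modulo null vectors.
\<close>

definition partial_isometry ::
  "('a::real_vector \<Rightarrow> real) \<Rightarrow> ('b::real_vector \<Rightarrow> real) \<Rightarrow> ('a \<times> 'b) set \<Rightarrow> bool" where
  "partial_isometry N M S \<longleftrightarrow> subspace S \<and> (\<forall>(a, b)\<in>S. N a = M b)"

text \<open>
  Separability is measured in the first coordinate; since the graph is isometric, the second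
  coordinate gives the same notion.
\<close>

definition separable_partial_isometry ::
  "('a::real_vector \<Rightarrow> real) \<Rightarrow> ('b::real_vector \<Rightarrow> real) \<Rightarrow> ('a \<times> 'b) set \<Rightarrow> bool" where
  "separable_partial_isometry N M S \<longleftrightarrow>
     partial_isometry N M S \<and> (\<exists>Q. separably_dense (N \<circ> fst) Q S)"

lemma separable_partial_isometryE:
  assumes "separable_partial_isometry N M S"
  obtains Q where "countable Q" "Q \<subseteq> S" "\<And>p e. p \<in> S \<Longrightarrow> e > 0 \<Longrightarrow> \<exists>q\<in>Q. N (fst (p - q)) < e"
proof -
  obtain Q where "separably_dense (N \<circ> fst) Q S"
    using assms by (auto simp: separable_partial_isometry_def)
  then show ?thesis by (intro that[of Q]) (simp_all add: separably_dense_def)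
qed

lemma partial_isometry_eq: "partial_isometry N M S \<Longrightarrow> (a, b) \<in> S \<Longrightarrow> N a = M b"
  by (auto simp: partial_isometry_def)

text \<open>
  Amalgamation. Given an isometry between parts of \<open>'a\<close> and \<open>'b\<close> and a point \<open>x\<close> of \<open>'a\<close>, the point
  \<open>x\<close> can be adjoined to \<open>'b\<close> in the same position relative to the common part. The seminorm is the
  largest possible one, induced by the quotient of the \<open>\<ell>\<^sub>1\<close>-sum in which both copies of the common
  part are identified: \<open>K (z, t)\<close> is the infimum of \<open>M (z - b) + N (a + t x)\<close> over all \<open>(a, b)\<close> in \<open>S\<close>.
\<close>

lemma amalgam_seminorm:
  fixes N :: "'a::real_vector \<Rightarrow> real" and M :: "'b::real_vector \<Rightarrow> real"
  assumes N: "seminorm N" and M: "seminorm M" and S: "partial_isometry N M S"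
  obtains K where "seminorm K" "\<And>z. K (z, 0 :: real) = M z"
    "\<And>a b t. (a, b) \<in> S \<Longrightarrow> K (b, t) = N (a + t *\<^sub>R x)"
proof -
  define E where "E z t = (\<lambda>(a, b). M (z - b) + N (a + t *\<^sub>R x)) ` S" for z and t :: real
  define K where "K = (\<lambda>(z, t). Inf (E z t))"
  have sub: "subspace S" using S by (simp add: partial_isometry_def)
  have zero: "(0, 0) \<in> S" using subspace_0[OF sub] by (simp add: zero_prod_def)
  then have ne: "E z t \<noteq> {}" for z t by (auto simp: E_def)
  have ge0: "0 \<le> r" if "r \<in> E z t" for r z t
    using that seminorm_nonneg[OF N] seminorm_nonneg[OF M] by (fastforce simp: E_def)
  then have bdd: "bdd_below (E z t)" for z t by (meson bdd_belowI)
  have le: "K (z, t) \<le> M (z - b) + N (a + t *\<^sub>R x)" if "(a, b) \<in> S" for z t a b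
    unfolding K_def prod.case by (rule cInf_lower[OF _ bdd]) (use that in \<open>force simp: E_def\<close>)
  have ge: "c \<le> K (z, t)" if "\<And>a b. (a, b) \<in> S \<Longrightarrow> c \<le> M (z - b) + N (a + t *\<^sub>R x)" for z t c
    unfolding K_def prod.case by (rule cInf_greatest[OF ne]) (use that in \<open>auto simp: E_def\<close>)
  have approx: "\<exists>a b. (a, b) \<in> S \<and> M (z - b) + N (a + t *\<^sub>R x) < K (z, t) + e" if "e > 0" for z t e
    using cInf_lessD[OF ne, of z t "K (z, t) + e"] that by (auto simp: K_def E_def)
  have triangle: "K (z + z', t + t') \<le> K (z, t) + K (z', t')" for z z' t t'
  proof (rule field_le_epsilon)
    fix e :: real assume "e > 0"
    then obtain a b a' b' where ab: "(a, b) \<in> S" "M (z - b) + N (a + t *\<^sub>R x) < K (z, t) + e / 2"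
      and ab': "(a', b') \<in> S" "M (z' - b') + N (a' + t' *\<^sub>R x) < K (z', t') + e / 2"
      using approx[of "e / 2"] by (meson half_gt_zero)
    have "(a + a', b + b') \<in> S" using subspace_add[OF sub ab(1) ab'(1)] by simp
    from le[OF this, of "z + z'" "t + t'"]
    have "K (z + z', t + t') \<le> M ((z - b) + (z' - b')) + N ((a + t *\<^sub>R x) + (a' + t' *\<^sub>R x))"
      by (simp add: algebra_simps)
    also have "\<dots> \<le> M (z - b) + M (z' - b') + (N (a + t *\<^sub>R x) + N (a' + t' *\<^sub>R x))"
      by (intro add_mono seminorm_triangle[OF M] seminorm_triangle[OF N])
    finally show "K (z + z', t + t') \<le> K (z, t) + K (z', t') + e" using ab(2) ab'(2) by simp
  qed
  have base: "K (z, 0) = M z" for z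
  proof (rule antisym)
    show "K (z, 0) \<le> M z" using le[OF zero, of z 0] by (simp add: seminorm_zero[OF N])
    show "M z \<le> K (z, 0)"
    proof (rule ge)
      fix a b assume "(a, b) \<in> S"
      then have "N a = M b" using partial_isometry_eq[OF S] by blast
      then show "M z \<le> M (z - b) + N (a + 0 *\<^sub>R x)"
        using seminorm_triangle_sub[OF M, of z b] by simp
    qed
  qed
  have scale: "K (r *\<^sub>R z, r * t) \<le> \<bar>r\<bar> * K (z, t)" if r: "r \<noteq> 0" for r z t
  proof -
    have "K (r *\<^sub>R z, r * t) / \<bar>r\<bar> \<le> K (z, t)"
    proof (rule ge)
      fix a b assume "(a, b) \<in> S"
      then have "(r *\<^sub>R a, r *\<^sub>R b) \<in> S" using subspace_scale[OF sub, of "(a, b)" r] by simp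
      from le[OF this, of "r *\<^sub>R z" "r * t"]
      have "K (r *\<^sub>R z, r * t) \<le> M (r *\<^sub>R (z - b)) + N (r *\<^sub>R (a + t *\<^sub>R x))"
        by (simp add: algebra_simps)
      then have "K (r *\<^sub>R z, r * t) \<le> \<bar>r\<bar> * (M (z - b) + N (a + t *\<^sub>R x))"
        by (simp add: seminorm_scale[OF M] seminorm_scale[OF N] distrib_left)
      then show "K (r *\<^sub>R z, r * t) / \<bar>r\<bar> \<le> M (z - b) + N (a + t *\<^sub>R x)"
        using r by (simp add: field_simps)
    qed
    then show ?thesis using r by (simp add: field_simps)
  qed
  show ?thesis
  proof (rule that)
    show "seminorm K"
    proof (rule seminorm_le_scaleI)
      show "K (p + q) \<le> K p + K q" for p q
        using triangle[of "fst p" "fst q" "snd p" "snd q"] by (cases p; cases q) simp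
      show "K 0 = 0" using base[of 0] by (simp add: zero_prod_def seminorm_zero[OF M])
      show "K (r *\<^sub>R p) \<le> \<bar>r\<bar> * K p" if "r \<noteq> 0" for r p
        using scale[OF that, of "fst p" "snd p"] by (cases p) simp
    qed
    show "K (z, 0) = M z" for z by (rule base)
    fix a b t assume ab: "(a, b) \<in> S"
    show "K (b, t) = N (a + t *\<^sub>R x)"
    proof (rule antisym)
      show "K (b, t) \<le> N (a + t *\<^sub>R x)" using le[OF ab, of b t] by (simp add: seminorm_zero[OF M])
      show "N (a + t *\<^sub>R x) \<le> K (b, t)"
      proof (rule ge)
        fix a' b' assume "(a', b') \<in> S"
        then have "(a - a', b - b') \<in> S" using subspace_diff[OF sub ab] by fastforce
        then have "M (b - b') = N (a - a')" using partial_isometry_eq[OF S] by fastforce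
        then show "N (a + t *\<^sub>R x) \<le> M (b - b') + N (a' + t *\<^sub>R x)"
          using seminorm_triangle[OF N, of "a - a'" "a' + t *\<^sub>R x"] by simp
      qed
    qed
  qed
qed

text \<open>
  The single step of back and forth: amalgamate \<open>x\<close> to the target, and realize there the values that
  the amalgam prescribes on a countable dense part of \<open>S\<close>. By continuity the values are then right on
  all of \<open>S\<close>, and by homogeneity on \<open>S + \<real>(x, y)\<close>.
\<close>

lemma one_point_extension:
  fixes N :: "'a::real_vector \<Rightarrow> real" and M :: "'b::real_vector \<Rightarrow> real"
  assumes N: "seminorm N" and M: "seminorm M" and sat: "one_point_saturated M"
    and S: "separable_partial_isometry N M S"
  obtains S' where "separable_partial_isometry N M S'" "S \<subseteq> S'" "x \<in> Domain S'"
proof -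
  have pS: "partial_isometry N M S" and sub: "subspace S"
    using S by (auto simp: separable_partial_isometry_def partial_isometry_def)
  obtain Q where Q: "countable Q" "Q \<subseteq> S" "\<And>p e. p \<in> S \<Longrightarrow> e > 0 \<Longrightarrow> \<exists>q\<in>Q. N (fst (p - q)) < e"
    by (rule separable_partial_isometryE[OF S]) (rule that; assumption)
  have zero: "(0, 0) \<in> S" using subspace_0[OF sub] by (simp add: zero_prod_def)
  then have "Q \<noteq> {}" using Q(3)[of "(0, 0)" 1] by auto
  then obtain f :: "nat \<Rightarrow> 'a \<times> 'b" where f: "range f = Q"
    using Q(1) by (metis range_from_nat_into)
  obtain K where K: "seminorm K" "\<And>z. K (z, 0 :: real) = M z"
      "\<And>a b t. (a, b) \<in> S \<Longrightarrow> K (b, t) = N (a + t *\<^sub>R x)"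
    using amalgam_seminorm[OF N M pS] by metis
  obtain y where y: "\<And>n. M (snd (f n) + y) = K (snd (f n), 1)"
    using sat[unfolded one_point_saturated_def, rule_format, of K "snd \<circ> f"] K by auto
  have y: "M (b + y) = N (a + x)" if ab: "(a, b) \<in> S" for a b
  proof -
    have "\<bar>M (b + y) - N (a + x)\<bar> \<le> 0 + e" if e: "e > 0" for e
    proof -
      obtain a' b' where q: "(a', b') \<in> Q" "N (a - a') < e / 2"
        using Q(3)[OF ab, of "e / 2"] e by fastforce
      then have q': "(a', b') \<in> S" using Q(2) by blast
      have "(a - a', b - b') \<in> S" using subspace_diff[OF sub ab q'] by simp
      then have eq: "M (b - b') = N (a - a')" using partial_isometry_eq[OF pS] by fastforce
      have "M (b' + y) = N (a' + x)"
        using q(1) f y K(3)[OF q', of 1] by (auto simp: image_iff) (metis snd_conv)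
      then show ?thesis
        using seminorm_triangle_sub[OF M, of "b + y" "b' + y"] seminorm_triangle_sub[OF M, of "b' + y" "b + y"]
          seminorm_triangle_sub[OF N, of "a + x" "a' + x"] seminorm_triangle_sub[OF N, of "a' + x" "a + x"]
          seminorm_minus_commute[OF M, of b b'] seminorm_minus_commute[OF N, of a a'] eq q(2)
        by simp
    qed
    then have "\<bar>M (b + y) - N (a + x)\<bar> \<le> 0" by (rule field_le_epsilon)
    then show ?thesis by simp
  qed
  define S' where "S' = {s + t *\<^sub>R (x, y) | s t. s \<in> S}"
  have S'I: "s + t *\<^sub>R (x, y) \<in> S'" if "s \<in> S" for s t using that unfolding S'_def by blast
  have isom: "N (a + t *\<^sub>R x) = M (b + t *\<^sub>R y)" if ab: "(a, b) \<in> S" for a b t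
  proof (cases "t = 0")
    case True then show ?thesis using partial_isometry_eq[OF pS ab] by simp
  next
    case False
    have "(inverse t *\<^sub>R a, inverse t *\<^sub>R b) \<in> S" using subspace_scale[OF sub ab, of "inverse t"] by simp
    from y[OF this]
    have "N (t *\<^sub>R (inverse t *\<^sub>R a + x)) = M (t *\<^sub>R (inverse t *\<^sub>R b + y))"
      unfolding seminorm_scale[OF N] seminorm_scale[OF M] by simp
    then show ?thesis using False by (simp add: scaleR_right_distrib)
  qed
  have "subspace S'"
  proof (rule subspaceI)
    show "0 \<in> S'" using S'I[OF zero, of 0] by (simp add: zero_prod_def)
    show "u + v \<in> S'" if uv: "u \<in> S'" "v \<in> S'" for u v
    proof -
      obtain s t s' t' where u: "u = s + t *\<^sub>R (x, y)" "s \<in> S" and v: "v = s' + t' *\<^sub>R (x, y)" "s' \<in> S"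
        using uv by (auto simp: S'_def)
      have "u + v = (s + s') + (t + t') *\<^sub>R (x, y)" unfolding u v scaleR_left_distrib by simp
      then show ?thesis using S'I[OF subspace_add[OF sub u(2) v(2)]] by metis
    qed
    show "r *\<^sub>R u \<in> S'" if uS: "u \<in> S'" for r u
    proof -
      obtain s t where u: "u = s + t *\<^sub>R (x, y)" "s \<in> S" using uS by (auto simp: S'_def)
      have "r *\<^sub>R u = r *\<^sub>R s + (r * t) *\<^sub>R (x, y)" unfolding u by (simp only: scaleR_right_distrib scaleR_scaleR)
      then show ?thesis using S'I[OF subspace_scale[OF sub u(2)]] by metis
    qed
  qed
  moreover have "N a = M b" if "(a, b) \<in> S'" for a b
    using that isom by (force simp: S'_def)
  ultimately have "partial_isometry N M S'" by (auto simp: partial_isometry_def)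
  moreover have "separably_dense (N \<circ> fst) ((\<lambda>(q, r). q + r *\<^sub>R (x, y)) ` (Q \<times> \<rat>)) S'"
    unfolding separably_dense_def
  proof (intro conjI ballI allI impI)
    show "countable ((\<lambda>(q, r). q + r *\<^sub>R (x, y)) ` (Q \<times> (\<rat> :: real set)))"
      using Q(1) countable_rat by blast
    show "(\<lambda>(q, r). q + r *\<^sub>R (x, y)) ` (Q \<times> \<rat>) \<subseteq> S'" using Q(2) S'I by auto
    fix p and e :: real assume p: "p \<in> S'" and e: "e > 0"
    obtain s t where p: "p = s + t *\<^sub>R (x, y)" "s \<in> S" using p by (auto simp: S'_def)
    obtain q where q: "q \<in> Q" "N (fst (s - q)) < e / 2" using Q(3)[OF p(2), of "e / 2"] e by auto
    obtain r where r: "r \<in> \<rat>" "N (t *\<^sub>R x - r *\<^sub>R x) < e / 2"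
      using scaleR_approx[OF N, of "e / 2"] e by (metis half_gt_zero)
    have eq: "fst (p - (q + r *\<^sub>R (x, y))) = fst (s - q) + (t *\<^sub>R x - r *\<^sub>R x)" by (simp add: p)
    have "(N \<circ> fst) (p - (q + r *\<^sub>R (x, y))) < e"
      unfolding o_def eq using seminorm_triangle[OF N, of "fst (s - q)" "t *\<^sub>R x - r *\<^sub>R x"] q(2) r(2) by simp
    then show "\<exists>q\<in>(\<lambda>(q, r). q + r *\<^sub>R (x, y)) ` (Q \<times> \<rat>). (N \<circ> fst) (p - q) < e"
      using q(1) r(1) by (intro bexI[of _ "q + r *\<^sub>R (x, y)"]) auto
  qed
  ultimately have "separable_partial_isometry N M S'" by (auto simp: separable_partial_isometry_def)
  moreover have "S \<subseteq> S'" using S'I[of _ 0] by auto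
  moreover have "x \<in> Domain S'" using S'I[OF zero, of 1] by auto
  ultimately show ?thesis using that by blast
qed

section \<open>Forth, and back and forth\<close>

lemma chain_directed:
  assumes "\<And>S T. S \<in> C \<Longrightarrow> T \<in> C \<Longrightarrow> S \<subseteq> T \<or> T \<subseteq> S" "C \<noteq> {}" "x \<in> \<Union>C" "y \<in> \<Union>C"
  obtains S where "S \<in> C" "x \<in> S" "y \<in> S"
  using assms by (metis UnionE subsetD)

lemma partial_isometry_Union_chain:
  assumes C: "\<And>S T. S \<in> C \<Longrightarrow> T \<in> C \<Longrightarrow> S \<subseteq> T \<or> T \<subseteq> S" "C \<noteq> {}"
    and P: "\<And>S. S \<in> C \<Longrightarrow> partial_isometry N M S"
  shows "partial_isometry N M (\<Union>C)"
proof -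
  have sub: "subspace S" if "S \<in> C" for S using P[OF that] by (simp add: partial_isometry_def)
  have "subspace (\<Union>C)"
  proof (rule subspaceI)
    show "0 \<in> \<Union>C" using C(2) sub subspace_0 by blast
    show "x + y \<in> \<Union>C" if xy: "x \<in> \<Union>C" "y \<in> \<Union>C" for x y
    proof -
      obtain S where "S \<in> C" "x \<in> S" "y \<in> S"
        using chain_directed[of C x y] C xy by blast
      then show ?thesis using sub subspace_add by blast
    qed
    show "c *\<^sub>R x \<in> \<Union>C" if "x \<in> \<Union>C" for c x
      using that sub subspace_scale by blast
  qed
  then show ?thesis using P by (auto simp: partial_isometry_def)
qed

lemma separable_partial_isometry_Union_chain:
  assumes C: "\<And>S T. S \<in> C \<Longrightarrow> T \<in> C \<Longrightarrow> S \<subseteq> T \<or> T \<subseteq> S" "C \<noteq> {}" "countable C"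
    and P: "\<And>S. S \<in> C \<Longrightarrow> separable_partial_isometry N M S"
  shows "separable_partial_isometry N M (\<Union>C)"
proof -
  obtain Q where Q: "\<And>S. S \<in> C \<Longrightarrow> separably_dense (N \<circ> fst) (Q S) S"
    using P unfolding separable_partial_isometry_def by metis
  have "separably_dense (N \<circ> fst) (\<Union>S\<in>C. Q S) (\<Union>C)"
    unfolding separably_dense_def
  proof (intro conjI ballI allI impI)
    show "countable (\<Union>S\<in>C. Q S)" using Q C(3) by (auto simp: separably_dense_def)
    show "(\<Union>S\<in>C. Q S) \<subseteq> \<Union>C" using Q by (auto simp: separably_dense_def)
    fix x and e :: real assume "x \<in> \<Union>C" "e > 0"
    then obtain S where S: "S \<in> C" "x \<in> S" by blast
    then obtain q where "q \<in> Q S" "(N \<circ> fst) (x - q) < e"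
      using Q[OF S(1)] \<open>e > 0\<close> unfolding separably_dense_def by blast
    then show "\<exists>q\<in>\<Union>S\<in>C. Q S. (N \<circ> fst) (x - q) < e" using S(1) by blast
  qed
  moreover have "partial_isometry N M (\<Union>C)"
    by (rule partial_isometry_Union_chain[OF C(1,2)]) (use P in \<open>auto simp: separable_partial_isometry_def\<close>)
  ultimately show ?thesis by (auto simp: separable_partial_isometry_def)
qed

text \<open>
  The poset consists of the separable partial isometries that extend \<open>S0\<close>; a requirement \<open>R i\<close> is met
  by containing one of the pairs in \<open>R i\<close>. The union over the whole chain need not be separable any more,
  but it is still a partial isometry.
\<close>

lemma extend_through_requirements:
  fixes R :: "'i \<Rightarrow> ('a::real_vector \<times> 'b::real_vector) set"
  assumes CH: "ctwo ^c natLeq =o cardSuc natLeq"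
    and I: "(UNIV :: 'i set) \<lesssim> (UNIV :: real set)"
    and step: "\<And>S i. separable_partial_isometry N M S \<Longrightarrow>
        \<exists>S'. separable_partial_isometry N M S' \<and> S \<subseteq> S' \<and> S' \<inter> R i \<noteq> {}"
    and S0: "separable_partial_isometry N M S0"
  shows "\<exists>S. partial_isometry N M S \<and> S0 \<subseteq> S \<and> (\<forall>i. S \<inter> R i \<noteq> {})"
proof -
  let ?P = "\<lambda>S. separable_partial_isometry N M S \<and> S0 \<subseteq> S"
  have "\<exists>f. (\<forall>i. ?P (f i) \<and> f i \<in> {S. S \<inter> R i \<noteq> {}}) \<and> (\<forall>i j. f i \<subseteq> f j \<or> f j \<subseteq> f i)"
  proof (rule generic_chain[OF CH I, of ?P "(\<subseteq>)" "\<lambda>i. {S. S \<inter> R i \<noteq> {}}"])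
    fix C assume C: "countable C" "\<And>S. S \<in> C \<Longrightarrow> ?P S"
      "\<And>S T. S \<in> C \<Longrightarrow> T \<in> C \<Longrightarrow> S \<subseteq> T \<or> T \<subseteq> S"
    show "\<exists>U. ?P U \<and> (\<forall>S\<in>C. S \<subseteq> U)"
    proof (cases "C = {}")
      case True then show ?thesis using S0 by auto
    next
      case False
      have "separable_partial_isometry N M (\<Union>C)"
        by (rule separable_partial_isometry_Union_chain[OF C(3) False C(1)]) (use C(2) in auto)
      moreover have "S0 \<subseteq> \<Union>C" using False C(2) by blast
      ultimately show ?thesis by (intro exI[of _ "\<Union>C"]) auto
    qed
  next
    fix S i assume "?P S"
    then have "separable_partial_isometry N M S" by simp
    from step[OF this, of i] obtain S'
      where "separable_partial_isometry N M S'" "S \<subseteq> S'" "S' \<inter> R i \<noteq> {}"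
      by (elim exE conjE)
    then show "\<exists>q. ?P q \<and> S \<subseteq> q \<and> q \<in> {S. S \<inter> R i \<noteq> {}}" using \<open>?P S\<close> by blast
  qed (rule order.refl, rule order.trans)
  then obtain f where f: "\<And>i. ?P (f i)" "\<And>i. f i \<in> {S. S \<inter> R i \<noteq> {}}"
    "\<And>i j. f i \<subseteq> f j \<or> f j \<subseteq> f i" by blast
  have "partial_isometry N M (\<Union>(range f))"
  proof (rule partial_isometry_Union_chain)
    show "S \<subseteq> T \<or> T \<subseteq> S" if "S \<in> range f" "T \<in> range f" for S T
      using that f(3) by blast
    show "partial_isometry N M S" if "S \<in> range f" for S
      using that f(1) by (auto simp: separable_partial_isometry_def)
  qed simp
  moreover have "S0 \<subseteq> \<Union>(range f)" using f(1) by blast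
  moreover have "\<Union>(range f) \<inter> R i \<noteq> {}" for i using f(2)[of i] by blast
  ultimately show ?thesis by blast
qed

lemma partial_isometry_converse:
  assumes "partial_isometry N M S"
  shows "partial_isometry M N (S\<inverse>)"
proof -
  have sub: "subspace S" using assms by (simp add: partial_isometry_def)
  have "subspace (S\<inverse>)"
  proof (rule subspaceI)
    show "0 \<in> S\<inverse>" using subspace_0[OF sub] by (simp add: zero_prod_def)
    show "x + y \<in> S\<inverse>" if "x \<in> S\<inverse>" "y \<in> S\<inverse>" for x y
      using that subspace_add[OF sub, of "prod.swap x" "prod.swap y"] by (cases x; cases y) simp
    show "c *\<^sub>R x \<in> S\<inverse>" if "x \<in> S\<inverse>" for c x
      using that subspace_scale[OF sub, of "prod.swap x" c] by (cases x) simp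
  qed
  then show ?thesis using assms by (auto simp: partial_isometry_def)
qed

lemma separable_partial_isometry_converse:
  assumes S: "separable_partial_isometry N M S"
  shows "separable_partial_isometry M N (S\<inverse>)"
proof -
  have p: "partial_isometry N M S" and sub: "subspace S"
    using S by (auto simp: separable_partial_isometry_def partial_isometry_def)
  obtain Q where Q: "countable Q" "Q \<subseteq> S" "\<And>p e. p \<in> S \<Longrightarrow> e > 0 \<Longrightarrow> \<exists>q\<in>Q. N (fst (p - q)) < e"
    by (rule separable_partial_isometryE[OF S]) (rule that; assumption)
  have eq: "N (fst (s - q)) = M (snd (s - q))" if "s \<in> S" "q \<in> S" for s q
    by (rule partial_isometry_eq[OF p]) (simp only: prod.collapse subspace_diff[OF sub that])
  have "separably_dense (M \<circ> fst) (prod.swap ` Q) (S\<inverse>)"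
    unfolding separably_dense_def
  proof (intro conjI ballI allI impI)
    show "countable (prod.swap ` Q)" using Q(1) by blast
    show "prod.swap ` Q \<subseteq> S\<inverse>" using Q(2) by auto
    fix p and e :: real assume "p \<in> S\<inverse>" "e > 0"
    then have s: "prod.swap p \<in> S" by (cases p) simp
    then obtain q where q: "q \<in> Q" "N (fst (prod.swap p - q)) < e" using Q(3) \<open>e > 0\<close> by blast
    then have "M (snd (prod.swap p - q)) < e" using eq[OF s, of q] Q(2) by auto
    then show "\<exists>q\<in>prod.swap ` Q. (M \<circ> fst) (p - q) < e"
      using q(1) by (intro bexI[of _ "prod.swap q"]) auto
  qed
  then show ?thesis using partial_isometry_converse[OF p] by (auto simp: separable_partial_isometry_def)
qed

lemma separable_partial_isometry_zero:
  fixes N :: "'a::real_vector \<Rightarrow> real" and M :: "'b::real_vector \<Rightarrow> real"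
  shows "seminorm N \<Longrightarrow> seminorm M \<Longrightarrow> separable_partial_isometry N M {0}"
  unfolding separable_partial_isometry_def partial_isometry_def separably_dense_def zero_prod_def
  by (intro conjI exI[of _ "{(0, 0)}"])
    (use subspace_single_0[where 'a = "'a \<times> 'b"] in \<open>auto simp: seminorm_zero zero_prod_def\<close>)

text \<open>
  One half of back and forth: the requirements concern the domain only.
\<close>

theorem universality_by_forth:
  fixes N :: "'a::real_vector \<Rightarrow> real" and M :: "'b::real_vector \<Rightarrow> real"
  assumes CH: "ctwo ^c natLeq =o cardSuc natLeq"
    and I: "(UNIV :: 'a set) \<lesssim> (UNIV :: real set)"
    and N: "seminorm N" and M: "seminorm M" "one_point_saturated M"
  obtains S where "partial_isometry N M S" "Domain S = UNIV"
proof -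
  have "\<exists>S. partial_isometry N M S \<and> {0} \<subseteq> S \<and> (\<forall>a. S \<inter> ({a} \<times> UNIV) \<noteq> {})"
  proof (rule extend_through_requirements[OF CH I, of N M "\<lambda>a. {a} \<times> UNIV" "{0}"])
    show "separable_partial_isometry N M {0}" by (rule separable_partial_isometry_zero[OF N M(1)])
    fix S a assume "separable_partial_isometry N M S"
    then obtain S' where "separable_partial_isometry N M S'" "S \<subseteq> S'" "a \<in> Domain S'"
      by (rule one_point_extension[OF N M, of S a]) (rule that; assumption)
    then show "\<exists>S'. separable_partial_isometry N M S' \<and> S \<subseteq> S' \<and> S' \<inter> ({a} \<times> UNIV) \<noteq> {}"
      by (intro exI[of _ S']) auto
  qed
  then obtain S where S: "partial_isometry N M S" "\<And>a. S \<inter> ({a} \<times> UNIV) \<noteq> {}" by blast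
  have "a \<in> Domain S" for a using S(2)[of a] by blast
  then show ?thesis using that S(1) by blast
qed

text \<open>
  The requirements alternate between putting a point of \<open>'a\<close> into the domain and a point of \<open>'b\<close>
  into the range.
\<close>

theorem back_and_forth:
  fixes N :: "'a::real_vector \<Rightarrow> real" and M :: "'b::real_vector \<Rightarrow> real"
  assumes CH: "ctwo ^c natLeq =o cardSuc natLeq"
    and I: "(UNIV :: 'a set) \<lesssim> (UNIV :: real set)" "(UNIV :: 'b set) \<lesssim> (UNIV :: real set)"
    and N: "seminorm N" "one_point_saturated N" and M: "seminorm M" "one_point_saturated M"
    and S0: "separable_partial_isometry N M S0"
  obtains S where "partial_isometry N M S" "S0 \<subseteq> S" "Domain S = UNIV" "Range S = UNIV"
proof -
  define R :: "'a + 'b \<Rightarrow> ('a \<times> 'b) set" where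
    "R i = (case i of Inl a \<Rightarrow> {a} \<times> UNIV | Inr b \<Rightarrow> UNIV \<times> {b})" for i
  have J: "(UNIV :: ('a + 'b) set) \<lesssim> (UNIV :: real set)"
  proof -
    obtain g :: "'a \<Rightarrow> real" and h :: "'b \<Rightarrow> real" where gh: "inj g" "inj h"
      using I by (auto simp: lepoll_def)
    let ?f = "case_sum (\<lambda>a. exp (g a)) (\<lambda>b. - exp (h b))"
    have "inj ?f"
    proof (rule injI)
      fix i j assume eq: "?f i = ?f j"
      have ne: "exp x \<noteq> - exp y" for x y :: real
        using exp_gt_zero[of x] exp_gt_zero[of y] by linarith
      show "i = j"
        using eq ne ne[symmetric] gh by (cases i; cases j) (auto dest: injD)
    qed
    then show ?thesis by (auto simp: lepoll_def)
  qed
  have "\<exists>S. partial_isometry N M S \<and> S0 \<subseteq> S \<and> (\<forall>i. S \<inter> R i \<noteq> {})"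
  proof (rule extend_through_requirements[OF CH J, of N M R S0])
    fix S i assume S: "separable_partial_isometry N M S"
    show "\<exists>S'. separable_partial_isometry N M S' \<and> S \<subseteq> S' \<and> S' \<inter> R i \<noteq> {}"
    proof (cases i)
      case (Inl a)
      obtain S' where "separable_partial_isometry N M S'" "S \<subseteq> S'" "a \<in> Domain S'"
        by (rule one_point_extension[OF N(1) M S, of a]) (rule that; assumption)
      then show ?thesis by (intro exI[of _ S']) (auto simp: R_def Inl)
    next
      case (Inr b)
      obtain S' where "separable_partial_isometry M N S'" "S\<inverse> \<subseteq> S'" "b \<in> Domain S'"
        by (rule one_point_extension[OF M(1) N separable_partial_isometry_converse[OF S], of b])
          (rule that; assumption)
      then show ?thesis
        using separable_partial_isometry_converse[of M N S'] by (intro exI[of _ "S'\<inverse>"]) (auto simp: R_def Inr)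
    qed
  qed (fact S0)
  then obtain S where S: "partial_isometry N M S" "S0 \<subseteq> S" "\<And>i. S \<inter> R i \<noteq> {}" by blast
  have "a \<in> Domain S" for a using S(3)[of "Inl a"] by (auto simp: R_def)
  moreover have "b \<in> Range S" for b using S(3)[of "Inr b"] by (auto simp: R_def)
  ultimately show ?thesis using that S by blast
qed

section \<open>A saturated seminorm on the free real vector space over the reals\<close>

instantiation poly_mapping :: (type, real_vector) real_vector
begin

lift_definition scaleR_poly_mapping :: "real \<Rightarrow> ('a \<Rightarrow>\<^sub>0 'b) \<Rightarrow> 'a \<Rightarrow>\<^sub>0 'b"
  is "\<lambda>r f i. r *\<^sub>R f i"
  by (erule finite_subset[rotated]) auto

instance
  by standard (transfer; auto simp: scaleR_right_distrib scaleR_left_distrib)+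

end

lemma lookup_scaleR [simp]: "Poly_Mapping.lookup (r *\<^sub>R x) i = r *\<^sub>R Poly_Mapping.lookup x i"
  by transfer simp

lift_definition restrict_coords :: "'i set \<Rightarrow> ('i \<Rightarrow>\<^sub>0 'b::zero) \<Rightarrow> 'i \<Rightarrow>\<^sub>0 'b"
  is "\<lambda>A f i. if i \<in> A then f i else 0"
  by (erule finite_subset[rotated]) auto

lemma lookup_restrict_coords [simp]:
  "Poly_Mapping.lookup (restrict_coords A x) i = (if i \<in> A then Poly_Mapping.lookup x i else 0)"
  by transfer simp

lemma restrict_coords_add:
  fixes x y :: "'i \<Rightarrow>\<^sub>0 real"
  shows "restrict_coords A (x + y) = restrict_coords A x + restrict_coords A y"
  by (rule poly_mapping_eqI) (simp add: lookup_add)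

lemma restrict_coords_scaleR:
  fixes x :: "'i \<Rightarrow>\<^sub>0 real"
  shows "restrict_coords A (r *\<^sub>R x) = r *\<^sub>R restrict_coords A x"
  by (rule poly_mapping_eqI) simp

lemma restrict_coords_restrict_coords:
  "restrict_coords A (restrict_coords B x) = restrict_coords (A \<inter> B) x"
  by (rule poly_mapping_eqI) auto

lemma restrict_coords_id: "Poly_Mapping.keys x \<subseteq> A \<Longrightarrow> restrict_coords A x = x"
  by (rule poly_mapping_eqI) (auto simp: in_keys_iff)

lemma nat_fun_real_lepoll_real: "(UNIV :: (nat \<Rightarrow> real) set) \<lesssim> (UNIV :: real set)"
proof -
  obtain g :: "nat set \<Rightarrow> real" where g: "inj g"
    using nat_sets_eqpoll_reals unfolding eqpoll_def by (blast dest: bij_is_inj)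
  obtain k :: "real \<Rightarrow> nat set" where k: "inj k"
    using eqpoll_sym[OF nat_sets_eqpoll_reals] unfolding eqpoll_def by (blast dest: bij_is_inj)
  define h where "h = (\<lambda>s :: nat \<Rightarrow> real. g {prod_encode (n, j) | n j. j \<in> k (s n)})"
  have "inj h"
  proof (rule injI)
    fix s t assume "h s = h t"
    then have "{prod_encode (n, j) | n j. j \<in> k (s n)} = {prod_encode (n, j) | n j. j \<in> k (t n)}"
      using injD[OF g] by (simp add: h_def)
    then have "j \<in> k (s n) \<longleftrightarrow> j \<in> k (t n)" for n j
      by (auto simp: set_eq_iff) (metis Pair_inject prod_encode_eq)+
    then have "k (s n) = k (t n)" for n by blast
    then show "s = t" by (intro ext injD[OF k])
  qed
  then show ?thesis by (auto simp: lepoll_def)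
qed

lemma lepoll_real_nat_fun:
  assumes "(UNIV :: 'a set) \<lesssim> (UNIV :: real set)"
  shows "(UNIV :: (nat \<Rightarrow> 'a) set) \<lesssim> (UNIV :: real set)"
proof -
  obtain g :: "'a \<Rightarrow> real" where g: "inj g" using assms by (auto simp: lepoll_def)
  have "inj (\<lambda>s :: nat \<Rightarrow> 'a. g \<circ> s)"
    using g by (auto intro!: injI simp: fun_eq_iff inj_eq)
  then have "(UNIV :: (nat \<Rightarrow> 'a) set) \<lesssim> (UNIV :: (nat \<Rightarrow> real) set)"
    unfolding lepoll_def by blast
  then show ?thesis using nat_fun_real_lepoll_real by (rule lepoll_trans)
qed

lemma lepoll_real_times:
  assumes "(UNIV :: 'a set) \<lesssim> (UNIV :: real set)" "(UNIV :: 'b set) \<lesssim> (UNIV :: real set)"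
  shows "(UNIV :: ('a \<times> 'b) set) \<lesssim> (UNIV :: real set)"
proof -
  obtain g :: "'a \<Rightarrow> real" and h :: "'b \<Rightarrow> real" where gh: "inj g" "inj h"
    using assms by (auto simp: lepoll_def)
  have "inj (\<lambda>(a, b). \<lambda>n :: nat. if n = 0 then g a else h b)"
  proof (rule injI, clarify)
    fix a b a' b' assume "(\<lambda>n :: nat. if n = 0 then g a else h b) = (\<lambda>n. if n = 0 then g a' else h b')"
    from fun_cong[OF this, of 0] fun_cong[OF this, of 1] show "a = a' \<and> b = b'"
      using gh by (simp add: inj_eq)
  qed
  then have "(UNIV :: ('a \<times> 'b) set) \<lesssim> (UNIV :: (nat \<Rightarrow> real) set)"
    unfolding lepoll_def by blast
  then show ?thesis using nat_fun_real_lepoll_real by (rule lepoll_trans)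
qed

text \<open>
  A finitely supported function is coded by a sequence whose first entry is the size of the support
  and whose further entries list the support and the values there.
\<close>

lemma poly_mapping_lepoll_real: "(UNIV :: (real \<Rightarrow>\<^sub>0 real) set) \<lesssim> (UNIV :: real set)"
proof -
  define c where "c = (\<lambda>s :: nat \<Rightarrow> real. \<Sum>k < nat \<lfloor>s 0\<rfloor>. Poly_Mapping.single (s (2 * k + 1)) (s (2 * k + 2)))"
  have "\<exists>s. c s = x" for x :: "real \<Rightarrow>\<^sub>0 real"
  proof -
    obtain f where f: "bij_betw f {..<card (Poly_Mapping.keys x)} (Poly_Mapping.keys x)"
      using ex_bij_betw_nat_finite[of "Poly_Mapping.keys x"] by (auto simp: atLeast0LessThan)
    define s where "s j = (if j = 0 then real (card (Poly_Mapping.keys x)) else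
        if odd j then f (j div 2) else Poly_Mapping.lookup x (f (j div 2 - 1)))" for j
    have "c s = (\<Sum>k<card (Poly_Mapping.keys x). Poly_Mapping.single (f k) (Poly_Mapping.lookup x (f k)))"
      by (simp add: c_def s_def)
    also have "\<dots> = (\<Sum>i\<in>Poly_Mapping.keys x. Poly_Mapping.single i (Poly_Mapping.lookup x i))"
      by (rule sum.reindex_bij_betw[OF f])
    also have "\<dots> = x" by (rule poly_mapping_eqI)
      (simp add: lookup_sum lookup_single when_def in_keys_iff)
    finally show ?thesis by blast
  qed
  then have "surj c" by (metis surjI)
  then have "(UNIV :: (real \<Rightarrow>\<^sub>0 real) set) \<lesssim> (UNIV :: (nat \<Rightarrow> real) set)"
    by (metis lepoll_iff subset_UNIV top.extremum_uniqueI order_refl)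
  then show ?thesis using nat_fun_real_lepoll_real by (rule lepoll_trans)
qed

text \<open>
  A condition is a seminorm on the span of countably many basis vectors. It is represented by a
  seminorm on the whole space that ignores the remaining coordinates, so that all conditions have the
  same domain.
\<close>

definition condition :: "real set \<times> ((real \<Rightarrow>\<^sub>0 real) \<Rightarrow> real) \<Rightarrow> bool" where
  "condition = (\<lambda>(A, N). countable A \<and> seminorm N \<and> (\<forall>x. N (restrict_coords A x) = N x))"

definition extended_by :: "real set \<times> ((real \<Rightarrow>\<^sub>0 real) \<Rightarrow> real) \<Rightarrow> real set \<times> ((real \<Rightarrow>\<^sub>0 real) \<Rightarrow> real) \<Rightarrow> bool" where
  "extended_by = (\<lambda>(A, N) (B, M). A \<subseteq> B \<and> (\<forall>x. M (restrict_coords A x) = N x))"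

lemma extended_by_trans:
  assumes "extended_by p q" "extended_by q s"
  shows "extended_by p s"
proof -
  obtain A N B M C K where pqs: "p = (A, N)" "q = (B, M)" "s = (C, K)"
    by (cases p; cases q; cases s) auto
  have AB: "A \<subseteq> B" "B \<subseteq> C" "\<And>x. M (restrict_coords A x) = N x" "\<And>x. K (restrict_coords B x) = M x"
    using assms by (auto simp: pqs extended_by_def)
  have "K (restrict_coords A x) = N x" for x
    using AB(3)[of x] AB(4)[of "restrict_coords A x"] AB(1)
    by (simp add: restrict_coords_restrict_coords Int_absorb1)
  then show ?thesis using AB by (auto simp: pqs extended_by_def)
qed

lemma chain_contains_finite:
  fixes f :: "'i \<Rightarrow> 'b set"
  assumes ch: "\<And>i j. i \<in> I \<Longrightarrow> j \<in> I \<Longrightarrow> f i \<subseteq> f j \<or> f j \<subseteq> f i" and ne: "I \<noteq> {}"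
    and X: "finite X" "X \<subseteq> (\<Union>i\<in>I. f i)"
  shows "\<exists>i\<in>I. X \<subseteq> f i"
  using X
proof (induction X rule: finite_induct)
  case empty then show ?case using ne by blast
next
  case (insert x X)
  then obtain i j where "i \<in> I" "X \<subseteq> f i" "j \<in> I" "x \<in> f j" by auto
  then show ?case using ch[of i j] by blast
qed

text \<open>
  A vector has finite support, so its relevant part lies in a single member of the chain, and any
  two such members agree on it. For countable chains this shows that the poset of conditions is
  countably closed; for the uncountable generic chain it yields the final seminorm.
\<close>

lemma chain_of_conditions_bounded:
  assumes P: "\<And>p. p \<in> C \<Longrightarrow> condition p"
    and ch: "\<And>p q. p \<in> C \<Longrightarrow> q \<in> C \<Longrightarrow> extended_by p q \<or> extended_by q p"
    and ne: "C \<noteq> {}"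
  shows "\<exists>N. seminorm N \<and> (\<forall>x. N (restrict_coords (\<Union>(fst ` C)) x) = N x) \<and>
    (\<forall>p\<in>C. extended_by p (\<Union>(fst ` C), N))"
proof -
  let ?B = "\<Union>(fst ` C)"
  have sub: "fst p \<subseteq> fst q \<or> fst q \<subseteq> fst p" if "p \<in> C" "q \<in> C" for p q
    using ch[OF that] by (auto simp: extended_by_def split: prod.splits)
  have inv: "snd p (restrict_coords (fst p) x) = snd p x" if "p \<in> C" for p x
    using P[OF that] by (auto simp: condition_def split: prod.splits)
  have agree: "snd q y = snd p y" if "p \<in> C" "q \<in> C" "Poly_Mapping.keys y \<subseteq> fst p" "Poly_Mapping.keys y \<subseteq> fst q" for p q y
    using ch[OF that(1,2)] that(3,4)
    by (auto simp: extended_by_def split: prod.splits) (metis restrict_coords_id)+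
  \<comment> \<open>a member of the chain that already contains the finite index set \<open>X\<close>\<close>
  define g where "g X = (SOME p. p \<in> C \<and> X \<subseteq> fst p)" for X
  have g: "g X \<in> C \<and> X \<subseteq> fst (g X)" if "finite X" "X \<subseteq> ?B" for X
    unfolding g_def by (rule someI_ex) (use chain_contains_finite[OF sub ne that] in blast)
  define N where "N x = snd (g (Poly_Mapping.keys (restrict_coords ?B x))) (restrict_coords ?B x)" for x
  have key: "Poly_Mapping.keys (restrict_coords ?B x) \<subseteq> ?B" for x :: "real \<Rightarrow>\<^sub>0 real"
    by (auto simp: in_keys_iff split: if_splits)
  have N: "N x = snd p (restrict_coords ?B x)" if "p \<in> C" "Poly_Mapping.keys (restrict_coords ?B x) \<subseteq> fst p" for p x
    unfolding N_def using agree[OF that(1) _ that(2)] g[OF finite_keys key] by blast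
  show ?thesis
  proof (intro exI[of _ N] conjI allI ballI)
    show "seminorm N"
    proof (rule seminormI)
      fix x y :: "real \<Rightarrow>\<^sub>0 real" and a :: real
      let ?X = "Poly_Mapping.keys (restrict_coords ?B x) \<union> Poly_Mapping.keys (restrict_coords ?B y)"
      have "finite ?X" "?X \<subseteq> ?B" using key[of x] key[of y] by simp_all
      from chain_contains_finite[OF sub ne this] obtain p where p: "p \<in> C" "?X \<subseteq> fst p" by blast
      have sp: "seminorm (snd p)" using P[OF p(1)] by (simp add: condition_def case_prod_beta)
      have "Poly_Mapping.keys (restrict_coords ?B (x + y)) \<subseteq> fst p"
        unfolding restrict_coords_add by (rule order_trans[OF Poly_Mapping.keys_add p(2)])
      then have "N (x + y) = snd p (restrict_coords ?B x + restrict_coords ?B y)"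
        using N[OF p(1)] by (simp add: restrict_coords_add)
      also have "\<dots> \<le> snd p (restrict_coords ?B x) + snd p (restrict_coords ?B y)"
        by (rule seminorm_triangle[OF sp])
      also have "\<dots> = N x + N y" using N[OF p(1)] p(2) by simp
      finally show "N (x + y) \<le> N x + N y" .
      have "Poly_Mapping.keys (restrict_coords ?B (a *\<^sub>R x)) \<subseteq> fst p"
        using p(2) unfolding restrict_coords_scaleR by (auto simp: in_keys_iff subset_iff)
      then have "N (a *\<^sub>R x) = snd p (a *\<^sub>R restrict_coords ?B x)"
        using N[OF p(1)] by (simp add: restrict_coords_scaleR)
      then show "N (a *\<^sub>R x) = \<bar>a\<bar> * N x"
        using N[OF p(1)] p(2) by (simp add: seminorm_scale[OF sp])
    qed
    show "N (restrict_coords ?B x) = N x" for x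
      by (simp add: N_def restrict_coords_restrict_coords)
    fix p assume p: "p \<in> C"
    have "N (restrict_coords (fst p) x) = snd p x" for x
    proof -
      have "fst p \<subseteq> ?B" using p by blast
      then have "restrict_coords ?B (restrict_coords (fst p) x) = restrict_coords (fst p) x"
        by (simp add: restrict_coords_restrict_coords Int_absorb1)
      moreover have "Poly_Mapping.keys (restrict_coords (fst p) x) \<subseteq> fst p"
        by (auto simp: in_keys_iff split: if_splits)
      ultimately show ?thesis using N[OF p] inv[OF p] by simp
    qed
    then show "extended_by p (?B, N)" using p by (cases p) (auto simp: extended_by_def)
  qed
qed

text \<open>
  Here \<open>M\<close> is a one-point extension of \<open>N\<close> that has distances \<open>snd (xs n)\<close> from the new point to
  \<open>- fst (xs n)\<close>.
\<close>

definition prescribed_extension :: "((real \<Rightarrow>\<^sub>0 real) \<Rightarrow> real) \<Rightarrow> (nat \<Rightarrow> (real \<Rightarrow>\<^sub>0 real) \<times> real) \<Rightarrow>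
    ((real \<Rightarrow>\<^sub>0 real) \<times> real \<Rightarrow> real) \<Rightarrow> bool" where
  "prescribed_extension N xs M \<longleftrightarrow> seminorm M \<and> (\<forall>y. M (y, 0) = N y) \<and> (\<forall>n. M (fst (xs n), 1) = snd (xs n))"

text \<open>
  Settling a prescription is final: a realization persists in all later conditions, and a prescription
  that no one-point extension meets now is not met by one of a later condition either, because its
  restriction to the present coordinates would meet it already.
\<close>

definition decides where
  "decides xs = {(A, N). (\<forall>n. Poly_Mapping.keys (fst (xs n)) \<subseteq> A) \<and>
     ((\<exists>M. prescribed_extension N xs M) \<longrightarrow> (\<exists>v. Poly_Mapping.keys v \<subseteq> A \<and> (\<forall>n. N (fst (xs n) + v) = snd (xs n))))}"

text \<open>
  If the prescription can be met, a basis vector with an index outside the countable set used so far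
  is free to play the role of the new point.
\<close>

lemma decides_dense:
  assumes "condition p"
  shows "\<exists>q. condition q \<and> extended_by p q \<and> q \<in> decides xs"
proof -
  obtain A N where p: "p = (A, N)" by (cases p)
  have A: "countable A" and N: "seminorm N" and inv: "\<And>x. N (restrict_coords A x) = N x"
    using assms by (auto simp: p condition_def)
  define B where "B = A \<union> (\<Union>n. Poly_Mapping.keys (fst (xs n)))"
  have B: "countable B" "A \<subseteq> B" "\<And>n. Poly_Mapping.keys (fst (xs n)) \<subseteq> B"
    using A by (auto simp: B_def intro!: countable_UN intro: countable_finite)
  have invB: "N (restrict_coords B x) = N x" for x
  proof -
    have "N (restrict_coords B x) = N (restrict_coords A (restrict_coords B x))" by (simp add: inv)
    also have "\<dots> = N x" using B(2) by (simp add: restrict_coords_restrict_coords Int_absorb2 inv)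
    finally show ?thesis .
  qed
  show ?thesis
  proof (cases "\<exists>M. prescribed_extension N xs M")
    case False
    then show ?thesis
      using B N invB inv by (intro exI[of _ "(B, N)"]) (auto simp: p condition_def extended_by_def decides_def)
  next
    case True
    then obtain M where "prescribed_extension N xs M" by blast
    then have M: "seminorm M" "\<And>y. M (y, 0) = N y" "\<And>n. M (fst (xs n), 1) = snd (xs n)"
      unfolding prescribed_extension_def by auto
    have "B \<noteq> UNIV" using B(1) uncountable_UNIV_real by auto
    then obtain c where c: "c \<notin> B" by blast
    define N' where "N' x = M (restrict_coords B x, Poly_Mapping.lookup x c)" for x
    have N': "seminorm N'"
    proof (rule seminormI)
      show "N' (x + y) \<le> N' x + N' y" for x y
        using seminorm_triangle[OF M(1), of "(restrict_coords B x, Poly_Mapping.lookup x c)" "(restrict_coords B y, Poly_Mapping.lookup y c)"]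
        by (simp add: N'_def restrict_coords_add lookup_add)
      show "N' (a *\<^sub>R x) = \<bar>a\<bar> * N' x" for a x
        using seminorm_scale[OF M(1), of a "(restrict_coords B x, Poly_Mapping.lookup x c)"]
        by (simp add: N'_def restrict_coords_scaleR)
    qed
    have "condition (insert c B, N')"
    proof -
      have "B \<inter> insert c B = B" by blast
      then show ?thesis
        using B(1) N' by (simp add: condition_def N'_def restrict_coords_restrict_coords)
    qed
    moreover have "extended_by p (insert c B, N')"
    proof -
      have "c \<notin> A" "B \<inter> A = A" using B(2) c by auto
      then show ?thesis using B(2)
        by (auto simp: p extended_by_def N'_def restrict_coords_restrict_coords M(2) inv)
    qed
    moreover have "(insert c B, N') \<in> decides xs"
    proof -
      let ?v = "Poly_Mapping.single c (1::real)"
      have v0: "restrict_coords B ?v = 0"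
        using c by (intro poly_mapping_eqI) (auto simp: lookup_single when_def)
      have "Poly_Mapping.lookup (fst (xs n)) c = 0" for n using c B(3)[of n] by (auto simp: in_keys_iff)
      then have "N' (fst (xs n) + ?v) = snd (xs n)" for n
        by (simp add: N'_def restrict_coords_add lookup_add v0 restrict_coords_id[OF B(3)] M(3))
      moreover have "Poly_Mapping.keys (fst (xs n)) \<subseteq> insert c B" for n using B(3) by blast
      moreover have "Poly_Mapping.keys ?v \<subseteq> insert c B" by simp
      ultimately show ?thesis unfolding decides_def by blast
    qed
    ultimately show ?thesis by blast
  qed
qed

text \<open>
  There are only continuum many prescriptions, namely sequences of pairs of a vector and a real, so a
  generic chain decides all of them. In the limit \<open>N\<close>, a prescription that is met by a one-point
  extension \<open>M\<close> of \<open>N\<close> is also met by a one-point extension of the seminorm in the condition that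
  decides it: compose \<open>M\<close> with the projection. So that condition realizes it, and hence so does \<open>N\<close>.
\<close>

theorem exists_one_point_saturated:
  assumes CH: "ctwo ^c natLeq =o cardSuc natLeq"
  obtains N :: "(real \<Rightarrow>\<^sub>0 real) \<Rightarrow> real" where "seminorm N" "one_point_saturated N"
proof -
  have I: "(UNIV :: (nat \<Rightarrow> (real \<Rightarrow>\<^sub>0 real) \<times> real) set) \<lesssim> (UNIV :: real set)"
    by (intro lepoll_real_nat_fun lepoll_real_times poly_mapping_lepoll_real lepoll_refl)
  have "\<exists>f. (\<forall>xs. condition (f xs) \<and> f xs \<in> decides xs) \<and>
      (\<forall>xs ys. extended_by (f xs) (f ys) \<or> extended_by (f ys) (f xs))"
  proof (rule generic_chain[OF CH I])
    show "extended_by p p" if "condition p" for p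
      using that by (auto simp: extended_by_def condition_def)
    show "extended_by p s" if "extended_by p q" "extended_by q s" for p q s
      using that by (rule extended_by_trans)
    show "\<exists>u. condition u \<and> (\<forall>p\<in>C. extended_by p u)"
      if C: "countable C" "\<And>p. p \<in> C \<Longrightarrow> condition p"
        "\<And>p q. p \<in> C \<Longrightarrow> q \<in> C \<Longrightarrow> extended_by p q \<or> extended_by q p" for C
    proof (cases "C = {}")
      case True
      have "condition ({}, \<lambda>_. 0)" by (simp add: condition_def seminorm_def)
      then show ?thesis using True by blast
    next
      case False
      have "\<exists>N. seminorm N \<and> (\<forall>x. N (restrict_coords (\<Union>(fst ` C)) x) = N x) \<and>
          (\<forall>p\<in>C. extended_by p (\<Union>(fst ` C), N))"
        by (rule chain_of_conditions_bounded) (rule C False; assumption?)+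
      then obtain N where "seminorm N" "\<forall>x. N (restrict_coords (\<Union>(fst ` C)) x) = N x"
        "\<forall>p\<in>C. extended_by p (\<Union>(fst ` C), N)" by (elim exE conjE)
      moreover have "countable (\<Union>(fst ` C))" 
      proof (rule countable_UN[OF C(1)])
        show "countable (fst p)" if "p \<in> C" for p
          using C(2)[OF that] by (auto simp: condition_def split: prod.splits)
      qed
      ultimately show ?thesis by (intro exI[of _ "(\<Union>(fst ` C), N)"]) (auto simp: condition_def)
    qed
    show "\<exists>q. condition q \<and> extended_by p q \<and> q \<in> decides xs" if "condition p" for p xs
      using that by (rule decides_dense)
  qed
  then obtain f where f: "\<And>xs. condition (f xs)" "\<And>xs. f xs \<in> decides xs"
    "\<And>xs ys. extended_by (f xs) (f ys) \<or> extended_by (f ys) (f xs)" by blast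
  let ?B = "\<Union>(fst ` range f)"
  have "\<exists>N. seminorm N \<and> (\<forall>x. N (restrict_coords ?B x) = N x) \<and>
    (\<forall>p\<in>range f. extended_by p (?B, N))"
  proof (rule chain_of_conditions_bounded)
    show "condition p" if "p \<in> range f" for p using that f(1) by blast
    show "extended_by p q \<or> extended_by q p" if "p \<in> range f" "q \<in> range f" for p q
      using that f(3) by blast
    show "range f \<noteq> {}" by simp
  qed
  then obtain N where N: "seminorm N" "\<And>p. p \<in> range f \<Longrightarrow> extended_by p (?B, N)" by blast
  have "one_point_saturated N"
    unfolding one_point_saturated_def
  proof (intro allI impI, elim conjE)
    fix x :: "nat \<Rightarrow> real \<Rightarrow>\<^sub>0 real" and M assume M: "seminorm M" "\<forall>y. M (y, 0 :: real) = N y"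
    define xs where "xs n = (x n, M (x n, 1))" for n
    obtain A N' where A: "f xs = (A, N')" by (cases "f xs")
    have st: "\<And>y. N (restrict_coords A y) = N' y" using N(2)[OF rangeI, of xs] by (auto simp: A extended_by_def)
    have keys: "Poly_Mapping.keys (x n) \<subseteq> A" for n
      using f(2)[of xs] A by (auto simp: decides_def xs_def)
    \<comment> \<open>the extension of the limit, seen by the condition that decides the prescription\<close>
    let ?M = "\<lambda>(y, t). M (restrict_coords A y, t)"
    have "prescribed_extension N' xs ?M"
      unfolding prescribed_extension_def
    proof (intro conjI allI)
      show "seminorm ?M"
      proof (rule seminormI)
        show "?M (p + q) \<le> ?M p + ?M q" for p q
          using seminorm_triangle[OF M(1), of "(restrict_coords A (fst p), snd p)" "(restrict_coords A (fst q), snd q)"]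
          by (cases p; cases q) (simp add: restrict_coords_add)
        show "?M (a *\<^sub>R p) = \<bar>a\<bar> * ?M p" for a p
          using seminorm_scale[OF M(1), of a "(restrict_coords A (fst p), snd p)"]
          by (cases p) (simp add: restrict_coords_scaleR)
      qed
      show "?M (y, 0) = N' y" for y using M(2) st by simp
      show "?M (fst (xs n), 1) = snd (xs n)" for n
        using restrict_coords_id[OF keys] by (simp add: xs_def)
    qed
    then obtain v where v: "Poly_Mapping.keys v \<subseteq> A" "\<And>n. N' (x n + v) = M (x n, 1)"
      using f(2)[of xs] A by (auto simp: decides_def xs_def)
    have "N (x n + v) = M (x n, 1)" for n
      using st[of "x n + v"] v by (simp add: restrict_coords_add restrict_coords_id keys)
    then show "\<exists>v. \<forall>n. N (x n + v) = M (x n, 1)" by blast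
  qed
  then show ?thesis using that N(1) by blast
qed

section \<open>Normed spaces with a carrier\<close>

lemma real_ring_simps [simp]:
  "carrier real_ring = UNIV" "add real_ring = (+)" "mult real_ring = (*)" "one real_ring = 1" "zero real_ring = 0"
  by (simp_all add: real_ring_def)

context normed_space
begin

lemma scale_closed [simp, intro]: "x \<in> carrier V \<Longrightarrow> a \<odot> x \<in> carrier V"
  by (rule smult_closed) simp_all

lemma scale_add_left: "x \<in> carrier V \<Longrightarrow> (a + b) \<odot> x = a \<odot> x \<oplus> b \<odot> x"
  using smult_l_distr[of a b x] by simp

lemma scale_scale: "x \<in> carrier V \<Longrightarrow> (a * b) \<odot> x = a \<odot> (b \<odot> x)"
  using smult_assoc1[of a b x] by simp

lemma scale_one [simp]: "x \<in> carrier V \<Longrightarrow> 1 \<odot> x = x"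
  using smult_one[of x] by simp

lemma scale_zero_left [simp]: "x \<in> carrier V \<Longrightarrow> 0 \<odot> x = \<zero>"
  using smult_l_null[of x] by simp

lemma uminus_eq_scale: "x \<in> carrier V \<Longrightarrow> \<ominus> x = (- 1) \<odot> x"
  using scale_add_left[of x 1 "- 1"] by (intro M.minus_equality[symmetric, of _ x, THEN sym]) (simp_all add: M.a_comm)

lemma nrm_minus_commute: "x \<in> carrier V \<Longrightarrow> y \<in> carrier V \<Longrightarrow> nrm V (x \<ominus> y) = nrm V (y \<ominus> x)"
  using nrm_minus[of "x \<ominus> y"] by (simp add: a_minus_def M.minus_add M.a_comm)

lemma nrm_diff_triangle:
  assumes "x \<in> carrier V" "y \<in> carrier V" "z \<in> carrier V"
  shows "nrm V (x \<ominus> z) \<le> nrm V (x \<ominus> y) + nrm V (y \<ominus> z)"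
proof -
  have "x \<ominus> z = (x \<ominus> y) \<oplus> (y \<ominus> z)"
    using assms by (simp add: a_minus_def M.a_assoc M.r_neg2 M.r_neg1)
  then show ?thesis using assms nrm_triangle[of "x \<ominus> y" "y \<ominus> z"] by simp
qed

lemma nrm_diff_eq_0_iff: "x \<in> carrier V \<Longrightarrow> y \<in> carrier V \<Longrightarrow> nrm V (x \<ominus> y) = 0 \<longleftrightarrow> x = y"
  using nrm_eq_0_iff[of "x \<ominus> y"] M.minus_equality[of x "\<ominus> y"] M.minus_minus M.r_neg
  by (auto simp: a_minus_def)

lemma in_closure_of_iff:
  assumes "S \<subseteq> carrier V"
  shows "x \<in> norm_topology V closure_of S \<longleftrightarrow> x \<in> carrier V \<and> (\<forall>e>0. \<exists>y\<in>S. nrm V (x \<ominus> y) < e)"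
proof -
  interpret M': Metric_space "carrier V" "mdist (norm_metric V)"
    using Metric_space_mspace_mdist[of "norm_metric V"] by simp
  have "norm_topology V = M'.mtopology" by (simp add: mtopology_of_def)
  moreover have "y \<in> M'.mball x e \<longleftrightarrow> nrm V (x \<ominus> y) < e" if "x \<in> carrier V" "y \<in> S" for x y e
    using that assms mdist_norm_metric[of x y] by auto
  ultimately show ?thesis
    by (simp add: M'.metric_closure_of del: M'.in_mball cong: conj_cong bex_cong)
qed

lemma closedin_iff:
  "closedin (norm_topology V) S \<longleftrightarrow> S \<subseteq> carrier V \<and>
    (\<forall>x\<in>carrier V. (\<forall>e>0. \<exists>y\<in>S. nrm V (x \<ominus> y) < e) \<longrightarrow> x \<in> S)"
proof (cases "S \<subseteq> carrier V")
  case True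
  then have "closedin (norm_topology V) S \<longleftrightarrow> norm_topology V closure_of S \<subseteq> S"
    using closure_of_subset_eq[of S "norm_topology V"] by simp
  then show ?thesis using in_closure_of_iff[OF True] True by auto
next
  case False
  then show ?thesis using closedin_subset[of "norm_topology V" S] by auto
qed

lemma complete_iff:
  "mcomplete_of (norm_metric V) \<longleftrightarrow>
    (\<forall>\<sigma> :: nat \<Rightarrow> 'a. range \<sigma> \<subseteq> carrier V \<and>
        (\<forall>e>0. \<exists>K. \<forall>m\<ge>K. \<forall>n\<ge>K. nrm V (\<sigma> m \<ominus> \<sigma> n) < e) \<longrightarrow>
      (\<exists>x\<in>carrier V. \<forall>e>0. \<exists>K. \<forall>n\<ge>K. nrm V (\<sigma> n \<ominus> x) < e))"
proof -
  interpret M': Metric_space "carrier V" "mdist (norm_metric V)"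
    using Metric_space_mspace_mdist[of "norm_metric V"] by simp
  have cau: "M'.MCauchy \<sigma> \<longleftrightarrow> range \<sigma> \<subseteq> carrier V \<and>
        (\<forall>e>0. \<exists>K. \<forall>m\<ge>K. \<forall>n\<ge>K. nrm V (\<sigma> m \<ominus> \<sigma> n) < e)" for \<sigma>
  proof (cases "range \<sigma> \<subseteq> carrier V")
    case True
    then have "mdist (norm_metric V) (\<sigma> m) (\<sigma> n) = nrm V (\<sigma> m \<ominus> \<sigma> n)" for m n
      by (intro mdist_norm_metric) auto
    then show ?thesis unfolding M'.MCauchy_def using True by simp
  qed (simp add: M'.MCauchy_def)
  have lim: "limitin M'.mtopology \<sigma> x sequentially \<longleftrightarrow>
       x \<in> carrier V \<and> (\<forall>e>0. \<exists>K. \<forall>n\<ge>K. nrm V (\<sigma> n \<ominus> x) < e)" if "range \<sigma> \<subseteq> carrier V" for \<sigma> x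
  proof -
    have "\<sigma> n \<in> carrier V" for n using that by auto
    then show ?thesis unfolding M'.limit_metric_sequentially using mdist_norm_metric by auto
  qed
  show ?thesis
    unfolding mcomplete_of_def mspace_norm_metric M'.mcomplete_def cau
    by (intro arg_cong[where f = All] ext imp_cong refl, elim conjE) (simp only: lim Bex_def)
qed

lemma closed_subspaceD:
  assumes "closed_subspace S V"
  shows "S \<subseteq> carrier V" "\<zero> \<in> S" "\<And>x y. x \<in> S \<Longrightarrow> y \<in> S \<Longrightarrow> x \<oplus> y \<in> S"
    "\<And>a x. x \<in> S \<Longrightarrow> a \<odot> x \<in> S" "\<And>x. x \<in> S \<Longrightarrow> \<ominus> x \<in> S" "submodule S real_ring V"
proof -
  show s: "submodule S real_ring V" using assms by (simp add: closed_subspace_def)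
  show "S \<subseteq> carrier V" "\<And>x y. x \<in> S \<Longrightarrow> y \<in> S \<Longrightarrow> x \<oplus> y \<in> S" "\<And>a x. x \<in> S \<Longrightarrow> a \<odot> x \<in> S"
      "\<And>x. x \<in> S \<Longrightarrow> \<ominus> x \<in> S"
    using submoduleE[OF s] by auto
  show "\<zero> \<in> S"
    using subgroup.one_closed[OF submodule.axioms(1)[OF s]] by simp
qed

lemma submodule_if_closed:
  assumes "S \<subseteq> carrier V" "S \<noteq> {}" "\<And>x y. x \<in> S \<Longrightarrow> y \<in> S \<Longrightarrow> x \<oplus> y \<in> S"
    "\<And>a x. x \<in> S \<Longrightarrow> a \<odot> x \<in> S"
  shows "submodule S real_ring V"
proof (rule submoduleI)
  obtain s where "s \<in> S" using assms(2) by blast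
  then show "\<zero> \<in> S" using assms(4)[of s 0] assms(1) by auto
  show "\<ominus> a \<in> S" if "a \<in> S" for a
    using assms(4)[OF that, of "- 1"] uminus_eq_scale[of a] that assms(1) by auto
qed (use assms in auto)

lemma uminus_subspace:
  assumes "submodule S real_ring V" "x \<in> S"
  shows "\<ominus>\<^bsub>subspace_of S V\<^esub> x = \<ominus> x"
proof -
  have sub: "S \<subseteq> carrier V" using submoduleE[OF assms(1)] by blast
  interpret S: module real_ring "subspace_of S V"
    by (rule submodule.submodule_is_module[OF assms(1)]) (rule module_axioms)
  have "\<ominus> x \<in> S" using submoduleE[OF assms(1)] assms(2) by blast
  then show ?thesis
    using S.M.minus_equality[of "\<ominus> x" x] assms(2) sub by (auto simp: M.l_neg)
qed

lemma minus_subspace: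
  assumes "submodule S real_ring V" "y \<in> S"
  shows "x \<ominus>\<^bsub>subspace_of S V\<^esub> y = x \<ominus> y"
  using uminus_subspace[OF assms] by (simp add: a_minus_def)

lemma normed_space_subspace:
  assumes "submodule S real_ring V"
  shows "normed_space (subspace_of S V)"
proof -
  have sub: "S \<subseteq> carrier V" using submoduleE[OF assms(1)] by blast
  interpret S: module real_ring "subspace_of S V"
    by (rule submodule.submodule_is_module[OF assms(1)]) (rule module_axioms)
  show ?thesis
  proof (intro normed_space.intro normed_space_axioms.intro)
    show "module real_ring (subspace_of S V)" by (rule S.module_axioms)
  qed (simp_all add: nrm_eq_0_iff nrm_triangle nrm_smult subsetD[OF sub])
qed

lemma separable_subspace_iff:
  assumes S: "submodule S real_ring V"
  shows "separable_space (norm_topology (subspace_of S V)) \<longleftrightarrow>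
    (\<exists>C. countable C \<and> C \<subseteq> S \<and> (\<forall>x\<in>S. \<forall>e>0. \<exists>c\<in>C. nrm V (x \<ominus> c) < e))"
proof -
  interpret S: normed_space "subspace_of S V" by (rule normed_space_subspace[OF S])
  have "norm_topology (subspace_of S V) closure_of C = S \<longleftrightarrow>
      (\<forall>x\<in>S. \<forall>e>0. \<exists>c\<in>C. nrm V (x \<ominus> c) < e)" if "C \<subseteq> S" for C
  proof -
    have "x \<in> norm_topology (subspace_of S V) closure_of C \<longleftrightarrow>
       x \<in> S \<and> (\<forall>e>0. \<exists>c\<in>C. nrm V (x \<ominus> c) < e)" for x
    proof -
      have "x \<ominus>\<^bsub>subspace_of S V\<^esub> c = x \<ominus> c" if "c \<in> C" for c
        using minus_subspace[OF S] that \<open>C \<subseteq> S\<close> by blast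
      then show ?thesis using S.in_closure_of_iff[of C x] \<open>C \<subseteq> S\<close> by simp
    qed
    then show ?thesis by blast
  qed
  then show ?thesis unfolding separable_space_def by auto
qed

end

lemma (in banach_space) cauchy_limit:
  fixes \<sigma> :: "nat \<Rightarrow> 'a"
  assumes "range \<sigma> \<subseteq> carrier V"
    and "\<forall>e>0. \<exists>K. \<forall>m\<ge>K. \<forall>n\<ge>K. nrm V (\<sigma> m \<ominus> \<sigma> n) < e"
  obtains x where "x \<in> carrier V" "\<forall>e>0. \<exists>K. \<forall>n\<ge>K. nrm V (\<sigma> n \<ominus> x) < e"
  using mp[OF spec[OF complete[unfolded complete_iff]], OF conjI[OF assms]] that by (elim bexE)

lemma banach_closed_subspace:
  assumes V: "banach_space V" and S: "closed_subspace S V"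
  shows "banach_space (subspace_of S V)"
proof -
  interpret V: banach_space V by (rule V)
  have sub: "submodule S real_ring V" "S \<subseteq> carrier V" using V.closed_subspaceD[OF S] by auto
  interpret S: normed_space "subspace_of S V" by (rule V.normed_space_subspace[OF sub(1)])
  have "mcomplete_of (norm_metric (subspace_of S V))"
    unfolding S.complete_iff
  proof (intro allI impI, elim conjE)
    fix \<sigma> :: "nat \<Rightarrow> 'a"
    assume ran: "range \<sigma> \<subseteq> carrier (subspace_of S V)"
      and "\<forall>e>0. \<exists>K. \<forall>m\<ge>K. \<forall>n\<ge>K. nrm (subspace_of S V) (\<sigma> m \<ominus>\<^bsub>subspace_of S V\<^esub> \<sigma> n) < e"
    have \<sigma>: "\<sigma> n \<in> S" for n using ran by auto
    then have "\<forall>e>0. \<exists>K. \<forall>m\<ge>K. \<forall>n\<ge>K. nrm V (\<sigma> m \<ominus>\<^bsub>V\<^esub> \<sigma> n) < e"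
      using \<open>\<forall>e>0. _\<close> by (simp add: V.minus_subspace[OF sub(1)])
    moreover have "range \<sigma> \<subseteq> carrier V" using \<sigma> sub(2) by auto
    ultimately obtain x where x: "x \<in> carrier V" "\<forall>e>0. \<exists>K. \<forall>n\<ge>K. nrm V (\<sigma> n \<ominus>\<^bsub>V\<^esub> x) < e"
      using V.cauchy_limit[of \<sigma>] by metis
    have "x \<in> S"
    proof -
      have "\<exists>y\<in>S. nrm V (x \<ominus>\<^bsub>V\<^esub> y) < e" if "e > 0" for e
      proof -
        obtain K where "nrm V (\<sigma> K \<ominus>\<^bsub>V\<^esub> x) < e" using x(2) \<open>e > 0\<close> by blast
        then have "nrm V (x \<ominus>\<^bsub>V\<^esub> \<sigma> K) < e"
          using V.nrm_minus_commute[of x "\<sigma> K"] x(1) subsetD[OF sub(2) \<sigma>[of K]] by simp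
        then show ?thesis using \<sigma> by blast
      qed
      then show ?thesis using S x(1) V.closedin_iff[of S] by (auto simp: closed_subspace_def)
    qed
    then show "\<exists>x\<in>carrier (subspace_of S V). \<forall>e>0. \<exists>K. \<forall>n\<ge>K.
        nrm (subspace_of S V) (\<sigma> n \<ominus>\<^bsub>subspace_of S V\<^esub> x) < e"
      using x(2) by (intro bexI[of _ x]) (simp_all add: V.minus_subspace[OF sub(1)])
  qed
  then show ?thesis
    by (rule banach_space.intro[OF S.normed_space_axioms banach_space_axioms.intro])
qed

lemma linear_isometry_diff:
  assumes X: "normed_space X" and Y: "normed_space Y" and T: "linear_isometry X Y T"
    and xy: "x \<in> carrier X" "y \<in> carrier X"
  shows "T (x \<ominus>\<^bsub>X\<^esub> y) = T x \<ominus>\<^bsub>Y\<^esub> T y" "nrm Y (T x \<ominus>\<^bsub>Y\<^esub> T y) = nrm X (x \<ominus>\<^bsub>X\<^esub> y)"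
proof -
  interpret X: normed_space X by (rule X)
  interpret Y: normed_space Y by (rule Y)
  have m: "T z \<in> carrier Y" if "z \<in> carrier X" for z
    using T that by (auto simp: linear_isometry_def bij_betw_def)
  show "T (x \<ominus>\<^bsub>X\<^esub> y) = T x \<ominus>\<^bsub>Y\<^esub> T y"
    using T xy m X.uminus_eq_scale[of y] Y.uminus_eq_scale[of "T y"]
    by (simp add: a_minus_def linear_isometry_def)
  then show "nrm Y (T x \<ominus>\<^bsub>Y\<^esub> T y) = nrm X (x \<ominus>\<^bsub>X\<^esub> y)"
    using T xy by (metis X.M.minus_closed linear_isometry_def)
qed

text \<open>
  A complete subspace is closed.
\<close>

lemma closed_subspace_isometric_image:
  assumes X: "banach_space X" and V: "normed_space V" and Y: "Y \<subseteq> carrier V"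
    and G: "linear_isometry X (subspace_of Y V) G"
  shows "closed_subspace Y V"
proof -
  interpret X: banach_space X by (rule X)
  interpret V: normed_space V by (rule V)
  have im: "Y = G ` carrier X" using G by (auto simp: linear_isometry_def bij_betw_def)
  have add: "G (x \<oplus>\<^bsub>X\<^esub> y) = G x \<oplus>\<^bsub>V\<^esub> G y" and scale: "G (a \<odot>\<^bsub>X\<^esub> x) = a \<odot>\<^bsub>V\<^esub> G x"
    if "x \<in> carrier X" "y \<in> carrier X" for x y a
    using G that by (auto simp: linear_isometry_def)
  have sub: "submodule Y real_ring V"
  proof (rule V.submodule_if_closed[OF Y])
    show "Y \<noteq> {}" using X.M.zero_closed im by blast
    show "x \<oplus>\<^bsub>V\<^esub> y \<in> Y" if "x \<in> Y" "y \<in> Y" for x y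
    proof -
      obtain x' y' where "x = G x'" "y = G y'" "x' \<in> carrier X" "y' \<in> carrier X" using \<open>x \<in> Y\<close> \<open>y \<in> Y\<close> im by blast
      then have "x \<oplus>\<^bsub>V\<^esub> y = G (x' \<oplus>\<^bsub>X\<^esub> y')" "x' \<oplus>\<^bsub>X\<^esub> y' \<in> carrier X" by (simp_all add: add)
      then show ?thesis unfolding im by blast
    qed
    show "a \<odot>\<^bsub>V\<^esub> x \<in> Y" if "x \<in> Y" for a x
    proof -
      obtain x' where "x = G x'" "x' \<in> carrier X" using \<open>x \<in> Y\<close> im by blast
      then have "a \<odot>\<^bsub>V\<^esub> x = G (a \<odot>\<^bsub>X\<^esub> x')" "a \<odot>\<^bsub>X\<^esub> x' \<in> carrier X" by (simp_all add: scale)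
      then show ?thesis unfolding im by blast
    qed
  qed
  interpret Y: normed_space "subspace_of Y V" by (rule V.normed_space_subspace[OF sub])
  have diff: "nrm V (G x \<ominus>\<^bsub>V\<^esub> G y) = nrm X (x \<ominus>\<^bsub>X\<^esub> y)" if "x \<in> carrier X" "y \<in> carrier X" for x y
  proof -
    have "G y \<in> Y" using that im by blast
    then show ?thesis
      using linear_isometry_diff(2)[OF X.normed_space_axioms Y.normed_space_axioms G that]
      by (simp add: V.minus_subspace[OF sub])
  qed
  have "w \<in> Y" if w: "w \<in> carrier V" "\<forall>e>0. \<exists>y\<in>Y. nrm V (w \<ominus>\<^bsub>V\<^esub> y) < e" for w
  proof -
    have "\<exists>x\<in>carrier X. nrm V (w \<ominus>\<^bsub>V\<^esub> G x) < inverse (Suc n)" for n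
      using w(2)[rule_format, of "inverse (Suc n)"] im by auto
    then obtain \<sigma> where \<sigma>: "\<And>n. \<sigma> n \<in> carrier X" "\<And>n. nrm V (w \<ominus>\<^bsub>V\<^esub> G (\<sigma> n)) < inverse (Suc n)"
      by metis
    have G_in: "G x \<in> carrier V" if "x \<in> carrier X" for x using that Y im by blast
    have small: "\<exists>K. \<forall>n\<ge>K. nrm V (w \<ominus>\<^bsub>V\<^esub> G (\<sigma> n)) < e" if e: "e > 0" for e
    proof -
      obtain K where K: "inverse (Suc K) < e" using e reals_Archimedean by blast
      have "nrm V (w \<ominus>\<^bsub>V\<^esub> G (\<sigma> n)) < e" if "n \<ge> K" for n
      proof -
        have "inverse (real (Suc n)) \<le> inverse (Suc K)" using that by (intro le_imp_inverse_le) auto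
        then show ?thesis using \<sigma>(2)[of n] K by linarith
      qed
      then show ?thesis by blast
    qed
    have "\<forall>e>0. \<exists>K. \<forall>m\<ge>K. \<forall>n\<ge>K. nrm X (\<sigma> m \<ominus>\<^bsub>X\<^esub> \<sigma> n) < e"
    proof (intro allI impI)
      fix e :: real assume "e > 0"
      then obtain K where K: "\<forall>n\<ge>K. nrm V (w \<ominus>\<^bsub>V\<^esub> G (\<sigma> n)) < e / 2" using small[of "e / 2"] by auto
      have "nrm X (\<sigma> m \<ominus>\<^bsub>X\<^esub> \<sigma> n) < e" if "m \<ge> K" "n \<ge> K" for m n
      proof -
        have "nrm V (G (\<sigma> m) \<ominus>\<^bsub>V\<^esub> G (\<sigma> n)) \<le> nrm V (w \<ominus>\<^bsub>V\<^esub> G (\<sigma> m)) + nrm V (w \<ominus>\<^bsub>V\<^esub> G (\<sigma> n))"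
          using V.nrm_diff_triangle[of "G (\<sigma> m)" w "G (\<sigma> n)"] V.nrm_minus_commute[of w "G (\<sigma> m)"]
            w(1) \<sigma>(1) G_in by simp
        then show ?thesis using K[rule_format, OF that(1)] K[rule_format, OF that(2)] diff \<sigma>(1) by simp
      qed
      then show "\<exists>K. \<forall>m\<ge>K. \<forall>n\<ge>K. nrm X (\<sigma> m \<ominus>\<^bsub>X\<^esub> \<sigma> n) < e" by blast
    qed
    moreover have "range \<sigma> \<subseteq> carrier X" using \<sigma>(1) by blast
    ultimately obtain x where x: "x \<in> carrier X" "\<forall>e>0. \<exists>K. \<forall>n\<ge>K. nrm X (\<sigma> n \<ominus>\<^bsub>X\<^esub> x) < e"
      using X.cauchy_limit[of \<sigma>] by metis
    have "nrm V (w \<ominus>\<^bsub>V\<^esub> G x) \<le> 0"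
    proof (rule field_le_epsilon)
      fix e :: real assume "e > 0"
      then obtain K K' where K: "\<forall>n\<ge>K. nrm V (w \<ominus>\<^bsub>V\<^esub> G (\<sigma> n)) < e / 2"
        "\<forall>n\<ge>K'. nrm X (\<sigma> n \<ominus>\<^bsub>X\<^esub> x) < e / 2"
        using small[of "e / 2"] x(2)[rule_format, of "e / 2"] by auto
      let ?n = "max K K'"
      have "nrm V (w \<ominus>\<^bsub>V\<^esub> G x) \<le> nrm V (w \<ominus>\<^bsub>V\<^esub> G (\<sigma> ?n)) + nrm V (G (\<sigma> ?n) \<ominus>\<^bsub>V\<^esub> G x)"
        using V.nrm_diff_triangle w(1) \<sigma>(1) x(1) G_in by blast
      also have "\<dots> \<le> e"
        using K(1)[rule_format, of ?n] K(2)[rule_format, of ?n] diff \<sigma>(1) x(1) by simp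
      finally show "nrm V (w \<ominus>\<^bsub>V\<^esub> G x) \<le> 0 + e" by simp
    qed
    then have "nrm V (w \<ominus>\<^bsub>V\<^esub> G x) = 0"
      using V.nrm_nonneg[of "w \<ominus>\<^bsub>V\<^esub> G x"] w(1) G_in x(1) by simp
    then have "w = G x" using V.nrm_diff_eq_0_iff[OF w(1) G_in[OF x(1)]] by simp
    then show "w \<in> Y" using im x(1) by blast
  qed
  then have "closedin (norm_topology V) Y" unfolding V.closedin_iff using Y by blast
  then show ?thesis using sub by (simp add: closed_subspace_def)
qed

section \<open>Presenting spaces by seminorms\<close>

text \<open>
  A presentation writes \<open>V\<close> as the quotient of a seminormed vector space by its null vectors, and
  thereby turns questions about \<open>V\<close> into questions about a seminorm on a fixed type of vectors, where
  the constructions above apply.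
\<close>

definition presents :: "('a::real_vector \<Rightarrow> real) \<Rightarrow> ('a \<Rightarrow> 'v) \<Rightarrow> 'v normed_space \<Rightarrow> bool" where
  "presents N L V \<longleftrightarrow> seminorm N \<and> normed_space V \<and> range L = carrier V \<and>
     (\<forall>x y. L (x + y) = L x \<oplus>\<^bsub>V\<^esub> L y) \<and> (\<forall>a x. L (a *\<^sub>R x) = a \<odot>\<^bsub>V\<^esub> L x) \<and>
     (\<forall>x. nrm V (L x) = N x)"

context
  fixes N :: "'a::real_vector \<Rightarrow> real" and L :: "'a \<Rightarrow> 'v" and V :: "'v normed_space"
  assumes P: "presents N L V"
begin

lemma presents_seminorm: "seminorm N"
  and presents_normed_space: "normed_space V"
  and presents_range: "range L = carrier V"
  and presents_in: "L x \<in> carrier V"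
  and presents_add: "L (x + y) = L x \<oplus>\<^bsub>V\<^esub> L y"
  and presents_scale: "L (a *\<^sub>R x) = a \<odot>\<^bsub>V\<^esub> L x"
  and presents_nrm: "nrm V (L x) = N x"
  using P by (auto simp: presents_def)

lemma presents_surj:
  assumes "v \<in> carrier V" obtains x where "v = L x"
  using assms presents_range by blast

lemma presents_zero: "L 0 = \<zero>\<^bsub>V\<^esub>"
proof -
  interpret V: normed_space V by (rule presents_normed_space)
  show ?thesis using presents_scale[of 0 0] V.scale_zero_left[OF presents_in] by simp
qed

lemma presents_diff: "L (x - y) = L x \<ominus>\<^bsub>V\<^esub> L y"
proof -
  interpret V: normed_space V by (rule presents_normed_space)
  have "L (x - y) = L (x + (- 1) *\<^sub>R y)" by simp
  also have "\<dots> = L x \<oplus>\<^bsub>V\<^esub> (- 1) \<odot>\<^bsub>V\<^esub> L y" by (simp only: presents_add presents_scale)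
  also have "\<dots> = L x \<ominus>\<^bsub>V\<^esub> L y" by (simp add: a_minus_def V.uminus_eq_scale presents_in)
  finally show ?thesis .
qed

lemma presents_dist: "nrm V (L x \<ominus>\<^bsub>V\<^esub> L y) = N (x - y)"
  using presents_nrm[of "x - y"] by (simp add: presents_diff)

lemma presents_eq_iff: "L x = L y \<longleftrightarrow> N (x - y) = 0"
proof -
  interpret V: normed_space V by (rule presents_normed_space)
  show ?thesis using V.nrm_diff_eq_0_iff[OF presents_in presents_in] presents_dist by metis
qed

end

text \<open>
  The quotient by the null vectors is carried by chosen representatives, which an injection into the
  reals turns into real numbers.
\<close>

lemma exists_presented:
  fixes N :: "'a::real_vector \<Rightarrow> real"
  assumes N: "seminorm N" and I: "(UNIV :: 'a set) \<lesssim> (UNIV :: real set)"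
  obtains L and V :: "real normed_space" where "presents N L V"
proof -
  obtain \<iota> :: "'a \<Rightarrow> real" where \<iota>: "inj \<iota>" using I by (auto simp: lepoll_def)
  define rep where "rep x = (SOME y. N (x - y) = 0)" for x
  define L where "L x = \<iota> (rep x)" for x
  \<comment> \<open>a section of \<open>L\<close>, through which the operations are defined\<close>
  define s where "s r = (SOME x. L x = r)" for r
  have rep: "N (x - rep x) = 0" for x
    unfolding rep_def by (rule someI[of _ x]) (simp add: seminorm_zero[OF N])
  have zero_trans: "N (x - z) = 0" if "N (x - y) = 0" "N (y - z) = 0" for x y z
    using seminorm_dist_triangle[OF N, of x z y] seminorm_nonneg[OF N, of "x - z"] that by simp
  have L_eqI: "L x = L y" if "N (x - y) = 0" for x y
  proof -
    have "N (x - z) = 0 \<longleftrightarrow> N (y - z) = 0" for z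
      using zero_trans[of x y z] zero_trans[of y x z] that seminorm_minus_commute[OF N, of x y] by auto
    then show ?thesis by (simp add: L_def rep_def)
  qed
  have L_eqD: "N (x - y) = 0" if "L x = L y" for x y
  proof -
    have "rep x = rep y" using that \<iota> by (simp add: L_def inj_eq)
    then show ?thesis
      using zero_trans[of x "rep x" y] rep[of x] rep[of y] seminorm_minus_commute[OF N, of y "rep y"] by simp
  qed
  have "L (s (L x)) = L x" for x unfolding s_def by (rule someI[of _ x]) simp
  then have s: "N (s (L x) - x) = 0" for x by (rule L_eqD)
  define V :: "real normed_space" where "V = \<lparr>carrier = range L, mult = undefined, one = undefined, zero = L 0,
    add = (\<lambda>a b. L (s a + s b)), smult = (\<lambda>r a. L (r *\<^sub>R s a)), nrm = (\<lambda>a. N (s a))\<rparr>"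
  have car: "carrier V = range L" and zero: "\<zero>\<^bsub>V\<^esub> = L 0" by (simp_all add: V_def)
  have add: "L x \<oplus>\<^bsub>V\<^esub> L y = L (x + y)" for x y
  proof -
    have "N ((s (L x) + s (L y)) - (x + y)) = N ((s (L x) - x) + (s (L y) - y))"
      by (simp add: algebra_simps)
    also have "\<dots> \<le> 0" using seminorm_triangle[OF N, of "s (L x) - x" "s (L y) - y"] s by simp
    finally show ?thesis
      using seminorm_nonneg[OF N] by (auto simp: V_def intro!: L_eqI antisym)
  qed
  have scale: "r \<odot>\<^bsub>V\<^esub> L x = L (r *\<^sub>R x)" for r x
  proof -
    have "N (r *\<^sub>R s (L x) - r *\<^sub>R x) = \<bar>r\<bar> * N (s (L x) - x)"
      by (metis scaleR_right_diff_distrib seminorm_scale[OF N])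
    then show ?thesis using s by (auto simp: V_def intro!: L_eqI)
  qed
  have nrm: "nrm V (L x) = N x" for x
    using seminorm_triangle_sub[OF N, of "s (L x)" x] seminorm_triangle_sub[OF N, of x "s (L x)"]
      s[of x] seminorm_minus_commute[OF N, of x "s (L x)"] by (simp add: V_def)
  have ab: "abelian_group V"
  proof (rule abelian_groupI)
    fix x assume "x \<in> carrier V"
    then obtain a where "x = L a" by (auto simp: car)
    then have "L (- a) \<oplus>\<^bsub>V\<^esub> x = \<zero>\<^bsub>V\<^esub>" by (simp add: add zero)
    then show "\<exists>y\<in>carrier V. y \<oplus>\<^bsub>V\<^esub> x = \<zero>\<^bsub>V\<^esub>" by (auto simp: car)
  qed (auto simp: car zero add algebra_simps)
  have module: "module real_ring V"
    by (rule moduleI[OF cring_real_ring ab])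
      (auto simp: car add scale scaleR_left_distrib scaleR_right_distrib)
  have eq0: "nrm V (L a) = 0 \<longleftrightarrow> L a = L 0" for a
    using L_eqI[of a 0] L_eqD[of a 0] by (auto simp: nrm)
  have "normed_space_axioms V"
    unfolding normed_space_axioms_def car zero
    using eq0 seminorm_triangle[OF N] seminorm_scale[OF N]
    by (auto simp: add scale nrm)
  with module have "normed_space V" by (rule normed_space.intro)
  then have "presents N L V"
    using N by (simp add: presents_def car add scale nrm)
  then show ?thesis using that by blast
qed

text \<open>
  A point is determined by a sequence from a dense subset that converges to it, and there are only
  continuum many such sequences.
\<close>

lemma carrier_lepoll_real:
  assumes CH: "ctwo ^c natLeq =o cardSuc natLeq"
    and X: "normed_space X" and dens: "density X \<le>o aleph1"
  shows "carrier X \<lesssim> (UNIV :: real set)"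
proof -
  interpret X: normed_space X by (rule X)
  obtain D where D: "dense_subset D X" "density X = |D|" using X.density_attained by blast
  have "|D| \<le>o |UNIV :: real set|"
    using dens D(2) card_real_eq_aleph1[OF CH] by (metis ordIso_symmetric ordLeq_ordIso_trans)
  then obtain g :: "_ \<Rightarrow> real" where g: "inj_on g D" by (auto simp: card_of_ordLeq[symmetric])
  have DX: "D \<subseteq> carrier X" using D(1) by (simp add: dense_subset_def)
  have "\<exists>y\<in>D. nrm X (x \<ominus>\<^bsub>X\<^esub> y) < inverse (Suc n)" if "x \<in> carrier X" for x and n :: nat
    using D(1) X.in_closure_of_iff[OF DX, of x] that by (auto simp: dense_subset_def)
  then obtain d where d: "\<And>x n. x \<in> carrier X \<Longrightarrow> d x n \<in> D"
      "\<And>x n. x \<in> carrier X \<Longrightarrow> nrm X (x \<ominus>\<^bsub>X\<^esub> d x n) < inverse (Suc n)"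
    by metis
  have "inj_on (\<lambda>x n. g (d x n)) (carrier X)"
  proof (rule inj_onI)
    fix x y assume xy: "x \<in> carrier X" "y \<in> carrier X" and eq: "(\<lambda>n. g (d x n)) = (\<lambda>n. g (d y n))"
    have deq: "d x n = d y n" for n using fun_cong[OF eq, of n] d(1) xy g by (auto dest: inj_onD)
    have "nrm X (x \<ominus>\<^bsub>X\<^esub> y) \<le> 0"
    proof (rule field_le_epsilon)
      fix e :: real assume "e > 0"
      then obtain n where n: "inverse (Suc n) < e / 2" using reals_Archimedean[of "e / 2"] by auto
      have c: "d y n \<in> carrier X" using d(1)[OF xy(2)] DX by blast
      have "nrm X (x \<ominus>\<^bsub>X\<^esub> y) \<le> nrm X (x \<ominus>\<^bsub>X\<^esub> d y n) + nrm X (y \<ominus>\<^bsub>X\<^esub> d y n)"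
        using X.nrm_diff_triangle[OF xy(1) c xy(2)] X.nrm_minus_commute[OF c xy(2)] by simp
      then show "nrm X (x \<ominus>\<^bsub>X\<^esub> y) \<le> 0 + e"
        using d(2)[OF xy(1), of n] d(2)[OF xy(2), of n] deq[of n] n by simp
    qed
    then show "x = y" using X.nrm_nonneg[of "x \<ominus>\<^bsub>X\<^esub> y"] X.nrm_diff_eq_0_iff[OF xy] xy by simp
  qed
  then have "carrier X \<lesssim> (UNIV :: (nat \<Rightarrow> real) set)" unfolding lepoll_def by blast
  then show ?thesis using nat_fun_real_lepoll_real by (rule lepoll_trans)
qed

text \<open>
  The basis vectors are sent onto all of the carrier, not just onto a dense part of it; so no
  completion has to be taken.
\<close>

lemma presented_by_free_space:
  assumes CH: "ctwo ^c natLeq =o cardSuc natLeq"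
    and X: "normed_space X" and dens: "density X \<le>o aleph1"
  obtains N :: "(real \<Rightarrow>\<^sub>0 real) \<Rightarrow> real" and L where "presents N L X"
proof -
  interpret X: normed_space X by (rule X)
  obtain g where g: "carrier X \<subseteq> g ` (UNIV :: real set)"
    using carrier_lepoll_real[OF assms] by (auto simp: lepoll_iff)
  define h where "h r = (if g r \<in> carrier X then g r else \<zero>\<^bsub>X\<^esub>)" for r :: real
  have h_in [simp]: "h r \<in> carrier X" for r by (simp add: h_def)
  have h_surj: "\<exists>r. x = h r" if x: "x \<in> carrier X" for x
  proof -
    obtain r where "x = g r" using g x by blast
    then show ?thesis using x by (auto simp: h_def)
  qed
  define L where "L x = finsum X (\<lambda>i. Poly_Mapping.lookup x i \<odot>\<^bsub>X\<^esub> h i) (Poly_Mapping.keys x)" for x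
  have L_in: "L x \<in> carrier X" for x by (auto simp: L_def intro!: X.M.finsum_closed)
  have L_superset: "L x = finsum X (\<lambda>i. Poly_Mapping.lookup x i \<odot>\<^bsub>X\<^esub> h i) A"
    if "finite A" "Poly_Mapping.keys x \<subseteq> A" for x A
    unfolding L_def by (rule X.M.add.finprod_mono_neutral_cong_left) (use that in \<open>auto simp: in_keys_iff\<close>)
  have L_add: "L (x + y) = L x \<oplus>\<^bsub>X\<^esub> L y" for x y
  proof -
    let ?A = "Poly_Mapping.keys x \<union> Poly_Mapping.keys y"
    have "L (x + y) = finsum X (\<lambda>i. Poly_Mapping.lookup (x + y) i \<odot>\<^bsub>X\<^esub> h i) ?A"
      by (rule L_superset) (simp_all add: Poly_Mapping.keys_add)
    also have "\<dots> = finsum X (\<lambda>i. Poly_Mapping.lookup x i \<odot>\<^bsub>X\<^esub> h i \<oplus>\<^bsub>X\<^esub> Poly_Mapping.lookup y i \<odot>\<^bsub>X\<^esub> h i) ?A"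
      by (simp add: lookup_add X.scale_add_left)
    also have "\<dots> = finsum X (\<lambda>i. Poly_Mapping.lookup x i \<odot>\<^bsub>X\<^esub> h i) ?A \<oplus>\<^bsub>X\<^esub>
        finsum X (\<lambda>i. Poly_Mapping.lookup y i \<odot>\<^bsub>X\<^esub> h i) ?A"
      by (rule X.M.finsum_addf) auto
    also have "\<dots> = L x \<oplus>\<^bsub>X\<^esub> L y" by (simp add: L_superset[of ?A])
    finally show ?thesis .
  qed
  have L_scale: "L (a *\<^sub>R x) = a \<odot>\<^bsub>X\<^esub> L x" for a x
  proof -
    have "L (a *\<^sub>R x) = finsum X (\<lambda>i. Poly_Mapping.lookup (a *\<^sub>R x) i \<odot>\<^bsub>X\<^esub> h i) (Poly_Mapping.keys x)"
      by (rule L_superset) (auto simp: in_keys_iff)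
    also have "\<dots> = finsum X (\<lambda>i. a \<odot>\<^bsub>X\<^esub> (Poly_Mapping.lookup x i \<odot>\<^bsub>X\<^esub> h i)) (Poly_Mapping.keys x)"
      by (simp add: X.scale_scale)
    also have "\<dots> = a \<odot>\<^bsub>X\<^esub> L x"
      unfolding L_def by (rule X.finsum_smult_ldistr[symmetric]) auto
    finally show ?thesis .
  qed
  have L_single: "L (Poly_Mapping.single r 1) = h r" for r
    using X.M.finsum_insert[of "{}" r "\<lambda>i. Poly_Mapping.lookup (Poly_Mapping.single r 1) i \<odot>\<^bsub>X\<^esub> h i"]
    by (simp add: L_def)
  have "presents (\<lambda>x. nrm X (L x)) L X"
    unfolding presents_def
  proof (intro conjI allI)
    show "seminorm (\<lambda>x. nrm X (L x))"
      by (rule seminormI) (simp_all add: L_add L_scale L_in X.nrm_triangle X.nrm_smult)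
    show "range L = carrier X" using L_in h_surj L_single by (metis image_subset_iff rangeI subsetI subset_antisym)
  qed (simp_all add: X L_add L_scale)
  then show ?thesis using that by blast
qed

section \<open>What saturation gives\<close>

text \<open>
  The limit of a Cauchy sequence \<open>a\<close> is the realization of a point that sits at its limit: the
  seminorms \<open>N (y + t a\<^sub>n)\<close> converge to a one-point extension in which the new point has distance
  \<open>lim N (a\<^sub>m - a\<^sub>n)\<close> from \<open>a\<^sub>n\<close>.
\<close>

lemma saturated_complete:
  fixes N :: "'a::real_vector \<Rightarrow> real" and a :: "nat \<Rightarrow> 'a"
  assumes N: "seminorm N" and sat: "one_point_saturated N"
    and cauchy: "\<forall>e>0. \<exists>K. \<forall>m\<ge>K. \<forall>n\<ge>K. N (a m - a n) < e"
  obtains v where "\<forall>e>0. \<exists>K. \<forall>n\<ge>K. N (a n - v) < e"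
proof -
  have diff: "\<bar>N (y + t *\<^sub>R a m) - N (y + t *\<^sub>R a n)\<bar> \<le> \<bar>t\<bar> * N (a m - a n)" for y t m n
  proof -
    have eq: "(y + t *\<^sub>R a m) - (y + t *\<^sub>R a n) = t *\<^sub>R (a m - a n)" by (simp add: scaleR_right_diff_distrib)
    have "N ((y + t *\<^sub>R a m) - (y + t *\<^sub>R a n)) = \<bar>t\<bar> * N (a m - a n)"
      unfolding eq by (rule seminorm_scale[OF N])
    then show ?thesis
      using seminorm_triangle_sub[OF N, of "y + t *\<^sub>R a m" "y + t *\<^sub>R a n"]
        seminorm_triangle_sub[OF N, of "y + t *\<^sub>R a n" "y + t *\<^sub>R a m"]
        seminorm_minus_commute[OF N, of "y + t *\<^sub>R a m" "y + t *\<^sub>R a n"] by linarith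
  qed
  have conv: "convergent (\<lambda>n. N (y + t *\<^sub>R a n))" for y t
  proof (rule Cauchy_convergent, rule CauchyI)
    fix e :: real assume "e > 0"
    then obtain K where K: "\<forall>m\<ge>K. \<forall>n\<ge>K. N (a m - a n) < e / (\<bar>t\<bar> + 1)"
      using cauchy by (metis abs_ge_zero add_nonneg_pos divide_pos_pos zero_less_one)
    have "norm (N (y + t *\<^sub>R a m) - N (y + t *\<^sub>R a n)) < e" if "m \<ge> K" "n \<ge> K" for m n
    proof -
      have "\<bar>t\<bar> * N (a m - a n) \<le> (\<bar>t\<bar> + 1) * N (a m - a n)"
        using seminorm_nonneg[OF N] by (intro mult_right_mono) auto
      also have "\<dots> < e" using K that by (simp add: pos_less_divide_eq mult.commute)
      finally show ?thesis using diff[of y t m n] by simp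
    qed
    then show "\<exists>M. \<forall>m\<ge>M. \<forall>n\<ge>M. norm (N (y + t *\<^sub>R a m) - N (y + t *\<^sub>R a n)) < e" by blast
  qed
  define M where "M p = lim (\<lambda>n. N (fst p + snd p *\<^sub>R a n))" for p
  have lim: "(\<lambda>n. N (fst p + snd p *\<^sub>R a n)) \<longlonglongrightarrow> M p" for p
    using conv by (simp add: M_def convergent_LIMSEQ_iff)
  have M: "seminorm M"
  proof (rule seminormI)
    fix p q
    show "M (p + q) \<le> M p + M q"
    proof (rule LIMSEQ_le[OF lim tendsto_add[OF lim lim]])
      have "N (fst (p + q) + snd (p + q) *\<^sub>R a n) \<le> N (fst p + snd p *\<^sub>R a n) + N (fst q + snd q *\<^sub>R a n)" for n
        using seminorm_triangle[OF N, of "fst p + snd p *\<^sub>R a n" "fst q + snd q *\<^sub>R a n"]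
        by (simp add: algebra_simps)
      then show "\<exists>K. \<forall>n\<ge>K. N (fst (p + q) + snd (p + q) *\<^sub>R a n) \<le>
          N (fst p + snd p *\<^sub>R a n) + N (fst q + snd q *\<^sub>R a n)" by blast
    qed
    fix r
    have "N (fst (r *\<^sub>R p) + snd (r *\<^sub>R p) *\<^sub>R a n) = \<bar>r\<bar> * N (fst p + snd p *\<^sub>R a n)" for n
      using seminorm_scale[OF N, of r "fst p + snd p *\<^sub>R a n"] by (simp add: algebra_simps)
    then show "M (r *\<^sub>R p) = \<bar>r\<bar> * M p"
      using lim[of "r *\<^sub>R p"] tendsto_mult_left[OF lim[of p], of "\<bar>r\<bar>"] by (simp add: LIMSEQ_unique)
  qed
  have "M (y, 0) = N y" for y using lim[of "(y, 0)"] by (simp add: LIMSEQ_const_iff)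
  then obtain v where v: "\<And>n. N (- a n + v) = M (- a n, 1)"
    using sat[unfolded one_point_saturated_def, rule_format, of M "\<lambda>n. - a n"] M by auto
  have "\<exists>K. \<forall>n\<ge>K. N (a n - v) < e" if "e > 0" for e
  proof -
    obtain K where K: "\<forall>m\<ge>K. \<forall>n\<ge>K. N (a m - a n) < e / 2" using cauchy \<open>e > 0\<close> by (meson half_gt_zero)
    have "N (a n - v) < e" if "n \<ge> K" for n
    proof -
      have "(\<lambda>m. N (a m - a n)) \<longlonglongrightarrow> M (- a n, 1)" using lim[of "(- a n, 1)"] by simp
      then have "M (- a n, 1) \<le> e / 2"
        by (rule LIMSEQ_le_const2) (use K that in \<open>auto intro: less_imp_le\<close>)
      then show ?thesis using v[of n] \<open>e > 0\<close> seminorm_minus_commute[OF N, of "a n" v] by simp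
    qed
    then show ?thesis by blast
  qed
  then show ?thesis using that by blast
qed

text \<open>
  Realize a point that is far from everything, namely the new point in the \<open>\<ell>\<^sub>1\<close>-sum with a line.
\<close>

lemma saturated_not_separable:
  fixes N :: "'a::real_vector \<Rightarrow> real"
  assumes N: "seminorm N" and sat: "one_point_saturated N" and Q: "countable Q"
  obtains v where "\<And>q. q \<in> Q \<Longrightarrow> N (v - q) \<ge> 1"
proof (cases "Q = {}")
  case False
  then obtain f :: "nat \<Rightarrow> 'a" where f: "range f = Q" using Q by (metis range_from_nat_into)
  define M where "M p = N (fst p) + \<bar>snd p\<bar>" for p
  have "seminorm M"
  proof (rule seminormI)
    show "M (p + q) \<le> M p + M q" for p q
      using seminorm_triangle[OF N, of "fst p" "fst q"] abs_triangle_ineq[of "snd p" "snd q"]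
      by (simp add: M_def)
    show "M (r *\<^sub>R p) = \<bar>r\<bar> * M p" for r p
      by (simp add: M_def seminorm_scale[OF N] abs_mult algebra_simps)
  qed
  then obtain v where v: "\<And>n. N (- f n + v) = M (- f n, 1)"
    using sat[unfolded one_point_saturated_def, rule_format, of M "\<lambda>n. - f n"] by (auto simp: M_def)
  have "N (v - q) \<ge> 1" if "q \<in> Q" for q
  proof -
    obtain n where "q = f n" using \<open>q \<in> Q\<close> f by blast
    then show ?thesis using v[of n] seminorm_nonneg[OF N, of "- f n"] by (simp add: M_def)
  qed
  then show ?thesis using that by blast
qed (use that in auto)

text \<open>
  A total partial isometry between presentations descends to the presented spaces, because it sends
  null vectors to null vectors.
\<close>

lemma induced_isometry:
  assumes NL: "presents N L V" and MK: "presents M K W"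
    and S: "partial_isometry N M S" and dom: "Domain S = UNIV"
  obtains G where "linear_isometry V (subspace_of (K ` Range S) W) G"
    "\<And>a b. (a, b) \<in> S \<Longrightarrow> G (L a) = K b"
proof -
  have sub: "subspace S" using S by (simp add: partial_isometry_def)
  have iso: "L a = L a' \<longleftrightarrow> K b = K b'" if "(a, b) \<in> S" "(a', b') \<in> S" for a b a' b'
  proof -
    have "(a - a', b - b') \<in> S" using subspace_diff[OF sub that] by simp
    then have "N (a - a') = M (b - b')" using partial_isometry_eq[OF S] by blast
    then show ?thesis by (simp add: presents_eq_iff[OF NL] presents_eq_iff[OF MK])
  qed
  define G where "G v = K (SOME b. \<exists>a. L a = v \<and> (a, b) \<in> S)" for v
  have G: "G (L a) = K b" if ab: "(a, b) \<in> S" for a b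
  proof -
    have "\<exists>b'. \<exists>a'. L a' = L a \<and> (a', b') \<in> S" using ab by blast
    then have "\<exists>a'. L a' = L a \<and> (a', SOME b'. \<exists>a'. L a' = L a \<and> (a', b') \<in> S) \<in> S" by (rule someI_ex)
    then show ?thesis unfolding G_def using iso ab by blast
  qed
  have ex: "\<exists>b. (a, b) \<in> S" for a using dom by blast
  have "linear_isometry V (subspace_of (K ` Range S) W) G"
    unfolding linear_isometry_def bij_betw_def
  proof (intro conjI inj_onI ballI allI)
    fix v w r assume "v \<in> carrier V" "w \<in> carrier V"
    then obtain a b a' b' where v: "v = L a" "(a, b) \<in> S" and w: "w = L a'" "(a', b') \<in> S"
      using presents_surj[OF NL] ex by metis
    show "v = w" if "G v = G w"
      using that iso[OF v(2) w(2)] G v w by simp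
    have "(a + a', b + b') \<in> S" using subspace_add[OF sub v(2) w(2)] by simp
    then show "G (v \<oplus>\<^bsub>V\<^esub> w) = G v \<oplus>\<^bsub>subspace_of (K ` Range S) W\<^esub> G w"
      using G v w by (simp add: presents_add[OF NL, symmetric] presents_add[OF MK, symmetric])
  next
    fix r v assume "v \<in> carrier V"
    then obtain a b where v: "v = L a" "(a, b) \<in> S"
      using presents_surj[OF NL] ex by metis
    have "(r *\<^sub>R a, r *\<^sub>R b) \<in> S" using subspace_scale[OF sub v(2), of r] by simp
    then show "G (r \<odot>\<^bsub>V\<^esub> v) = r \<odot>\<^bsub>subspace_of (K ` Range S) W\<^esub> G v"
      using G v by (simp add: presents_scale[OF NL, symmetric] presents_scale[OF MK, symmetric])
  next
    fix v assume "v \<in> carrier V"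
    then obtain a b where v: "v = L a" "(a, b) \<in> S"
      using presents_surj[OF NL] ex by metis
    then show "nrm (subspace_of (K ` Range S) W) (G v) = nrm V v"
      using G partial_isometry_eq[OF S v(2)] by (simp add: presents_nrm[OF NL] presents_nrm[OF MK])
  next
    have "G ` carrier V = K ` Range S"
    proof
      show "G ` carrier V \<subseteq> K ` Range S"
      proof
        fix w assume "w \<in> G ` carrier V"
        then obtain v where "v \<in> carrier V" "w = G v" by blast
        then obtain a b where "v = L a" "(a, b) \<in> S" using presents_surj[OF NL] ex by metis
        then show "w \<in> K ` Range S" using G \<open>w = G v\<close> by auto
      qed
      show "K ` Range S \<subseteq> G ` carrier V"
      proof
        fix w assume "w \<in> K ` Range S"
        then obtain a b where "w = K b" "(a, b) \<in> S" by blast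
        then show "w \<in> G ` carrier V" using G[of a b] presents_in[OF NL, of a] by (metis imageI)
      qed
    qed
    then show "G ` carrier V = carrier (subspace_of (K ` Range S) W)" by simp
  qed
  then show ?thesis using that G by blast
qed

lemma saturated_banach:
  fixes N :: "'a::real_vector \<Rightarrow> real"
  assumes P: "presents N L V" and sat: "one_point_saturated N"
  shows "banach_space V"
proof -
  interpret V: normed_space V by (rule presents_normed_space[OF P])
  have "mcomplete_of (norm_metric V)"
    unfolding V.complete_iff
  proof (intro allI impI, elim conjE)
    fix \<sigma> :: "nat \<Rightarrow> _"
    assume ran: "range \<sigma> \<subseteq> carrier V"
      and cau: "\<forall>e>0. \<exists>K. \<forall>m\<ge>K. \<forall>n\<ge>K. nrm V (\<sigma> m \<ominus>\<^bsub>V\<^esub> \<sigma> n) < e"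
    have "\<exists>a. \<sigma> n = L a" for n using ran presents_range[OF P] by blast
    then obtain a where a: "\<And>n. \<sigma> n = L (a n)" by metis
    have "\<forall>e>0. \<exists>K. \<forall>m\<ge>K. \<forall>n\<ge>K. N (a m - a n) < e"
      using cau by (simp add: a presents_dist[OF P])
    from saturated_complete[OF presents_seminorm[OF P] sat this]
    obtain v where "\<forall>e>0. \<exists>K. \<forall>n\<ge>K. N (a n - v) < e" .
    then show "\<exists>x\<in>carrier V. \<forall>e>0. \<exists>K. \<forall>n\<ge>K. nrm V (\<sigma> n \<ominus>\<^bsub>V\<^esub> x) < e"
      by (intro bexI[of _ "L v"]) (simp_all add: a presents_dist[OF P] presents_in[OF P])
  qed
  then show ?thesis
    by (rule banach_space.intro[OF V.normed_space_axioms banach_space_axioms.intro])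
qed

lemma saturated_density:
  fixes N :: "'a::real_vector \<Rightarrow> real"
  assumes CH: "ctwo ^c natLeq =o cardSuc natLeq" and I: "(UNIV :: 'a set) \<lesssim> (UNIV :: real set)"
    and P: "presents N L V" and sat: "one_point_saturated N"
  shows "density V =o aleph1"
proof -
  interpret V: normed_space V by (rule presents_normed_space[OF P])
  note real = card_real_eq_aleph1[OF CH]
  obtain D where D: "dense_subset D V" "density V = |D|" using V.density_attained by blast
  have DV: "D \<subseteq> carrier V" using D(1) by (simp add: dense_subset_def)
  have "D \<lesssim> (UNIV :: real set)"
  proof -
    have "D \<lesssim> range L" using DV presents_range[OF P] by (simp add: subset_imp_lepoll)
    also have "range L \<lesssim> (UNIV :: 'a set)" by (rule image_lepoll)
    finally show ?thesis using I by (rule lepoll_trans)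
  qed
  then have "|D| \<le>o |UNIV :: real set|" by (auto simp: lepoll_def card_of_ordLeq[symmetric])
  then have "|D| \<le>o aleph1" using real ordLeq_ordIso_trans by blast
  moreover have "aleph1 \<le>o |D|"
  proof (rule ccontr)
    assume "\<not> aleph1 \<le>o |D|"
    moreover have "Well_order aleph1"
      by (rule card_order_on_well_order_on[OF cardSuc_Card_order[OF natLeq_Card_order]])
    ultimately have "|D| <o aleph1"
      using not_ordLeq_iff_ordLess[OF card_of_Well_order] by blast
    then have "countable D"
      by (simp add: countable_card_le_natLeq cardSuc_ordLeq_ordLess card_of_Card_order natLeq_Card_order card_of_card_order_on)
    define s where "s d = (SOME x. L x = d)" for d
    have s: "L (s d) = d" if "d \<in> D" for d
    proof -
      have "d \<in> range L" using that DV presents_range[OF P] by blast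
      then show ?thesis unfolding s_def by (metis (mono_tags, lifting) rangeE someI_ex)
    qed
    have "countable (s ` D)" using \<open>countable D\<close> by blast
    then obtain v where v: "\<And>q. q \<in> s ` D \<Longrightarrow> N (v - q) \<ge> 1"
      using saturated_not_separable[OF presents_seminorm[OF P] sat, of "s ` D"] by metis
    have "L v \<in> norm_topology V closure_of D" using D(1) presents_in[OF P] by (simp add: dense_subset_def)
    then obtain d where d: "d \<in> D" "nrm V (L v \<ominus>\<^bsub>V\<^esub> d) < 1"
      using V.in_closure_of_iff[OF DV] zero_less_one by blast
    then have "N (v - s d) < 1" using presents_dist[OF P, of v "s d"] s by simp
    then show False using v[of "s d"] d(1) by simp
  qed
  ultimately show ?thesis using D(2) ordIso_iff_ordLeq by metis
qed

lemma saturated_universal: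
  fixes N :: "'a::real_vector \<Rightarrow> real"
  assumes CH: "ctwo ^c natLeq =o cardSuc natLeq"
    and P: "presents N L V" and sat: "one_point_saturated N"
  shows "universal_aleph1 TYPE('x) V"
  unfolding universal_aleph1_def
proof (intro allI impI, elim conjE)
  fix X :: "'x normed_space" assume X: "banach_space X" "density X \<le>o aleph1"
  have nX: "normed_space X" using X(1) by (simp add: banach_space_def)
  obtain M :: "(real \<Rightarrow>\<^sub>0 real) \<Rightarrow> real" and K where MK: "presents M K X"
    using presented_by_free_space[OF CH nX X(2)] by blast
  obtain S where S: "partial_isometry M N S" "Domain S = UNIV"
    using universality_by_forth[OF CH poly_mapping_lepoll_real presents_seminorm[OF MK] presents_seminorm[OF P] sat] by blast
  obtain G where G: "linear_isometry X (subspace_of (L ` Range S) V) G"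
    using induced_isometry[OF MK P S] by blast
  have "L ` Range S \<subseteq> carrier V" using presents_in[OF P] by blast
  then have "closed_subspace (L ` Range S) V"
    using closed_subspace_isometric_image[OF X(1) presents_normed_space[OF P] _ G] by blast
  then show "isometric_to_subspace X V"
    using G by (auto simp: isometric_to_subspace_def linearly_isometric_def)
qed

text \<open>
  The preimage of the graph of \<open>T\<close> under the presentation is a separable partial isometry. As it is
  contained in the result of back and forth, the resulting map extends \<open>T\<close> on all of \<open>X\<close>.
\<close>

lemma saturated_extends_isometries:
  fixes N :: "'a::real_vector \<Rightarrow> real"
  assumes CH: "ctwo ^c natLeq =o cardSuc natLeq" and I: "(UNIV :: 'a set) \<lesssim> (UNIV :: real set)"
    and P: "presents N L V" and sat: "one_point_saturated N"
  shows "extends_separable_isometries V"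
  unfolding extends_separable_isometries_def
proof (intro allI impI, elim conjE)
  fix X Y T
  assume X: "closed_subspace X V" "separable_space (norm_topology (subspace_of X V))"
    and Y: "closed_subspace Y V" "separable_space (norm_topology (subspace_of Y V))"
    and T: "linear_isometry (subspace_of X V) (subspace_of Y V) T"
  interpret V: normed_space V by (rule presents_normed_space[OF P])
  note N = presents_seminorm[OF P]
  note XD = V.closed_subspaceD[OF X(1)] and YD = V.closed_subspaceD[OF Y(1)]
  have T_in: "T x \<in> Y" if "x \<in> X" for x
    using T that by (auto simp: linear_isometry_def bij_betw_def)
  have T_add: "T (x \<oplus>\<^bsub>V\<^esub> y) = T x \<oplus>\<^bsub>V\<^esub> T y" if "x \<in> X" "y \<in> X" for x y
    using T that by (simp add: linear_isometry_def)
  have T_scale: "T (r \<odot>\<^bsub>V\<^esub> x) = r \<odot>\<^bsub>V\<^esub> T x" if "x \<in> X" for r x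
    using T that by (simp add: linear_isometry_def)
  have T_nrm: "nrm V (T x) = nrm V x" if "x \<in> X" for x
    using T that by (simp add: linear_isometry_def)
  define S0 where "S0 = {(a, b). L a \<in> X \<and> T (L a) = L b}"
  have T0: "T \<zero>\<^bsub>V\<^esub> = \<zero>\<^bsub>V\<^esub>"
    using T_scale[OF XD(2), of 0] V.scale_zero_left[of "\<zero>\<^bsub>V\<^esub>"] V.scale_zero_left[of "T \<zero>\<^bsub>V\<^esub>"]
      T_in[OF XD(2)] YD(1) by auto
  have "subspace S0"
  proof (rule subspaceI)
    show "0 \<in> S0" by (simp add: S0_def zero_prod_def presents_zero[OF P] XD(2) T0)
    show "p + q \<in> S0" if "p \<in> S0" "q \<in> S0" for p q
      using that by (auto simp: S0_def presents_add[OF P] XD(3) T_add)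
    show "r *\<^sub>R p \<in> S0" if "p \<in> S0" for r p
      using that by (auto simp: S0_def presents_scale[OF P] XD(4) T_scale)
  qed
  moreover have "N a = N b" if "(a, b) \<in> S0" for a b
    using that T_nrm[of "L a"] presents_nrm[OF P, of a] presents_nrm[OF P, of b] by (simp add: S0_def)
  ultimately have S0: "partial_isometry N N S0" by (auto simp: partial_isometry_def)
  obtain C where C: "countable C" "C \<subseteq> X" "\<And>x e. x \<in> X \<Longrightarrow> e > 0 \<Longrightarrow> \<exists>c\<in>C. nrm V (x \<ominus>\<^bsub>V\<^esub> c) < e"
    using X(2) V.separable_subspace_iff[OF XD(6)] by blast
  have "\<exists>p\<in>S0. L (fst p) = c" if "c \<in> C" for c
  proof -
    have "c \<in> X" using that C(2) by blast
    then obtain a b where "c = L a" "T c = L b"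
      using XD(1) YD(1) T_in presents_surj[OF P] by (metis subsetD)
    then show ?thesis using \<open>c \<in> X\<close> by (intro bexI[of _ "(a, b)"]) (simp_all add: S0_def)
  qed
  then obtain q where q: "\<And>c. c \<in> C \<Longrightarrow> q c \<in> S0" "\<And>c. c \<in> C \<Longrightarrow> L (fst (q c)) = c" by metis
  have "separably_dense (N \<circ> fst) (q ` C) S0"
    unfolding separably_dense_def
  proof (intro conjI ballI allI impI)
    show "countable (q ` C)" using C(1) by blast
    show "q ` C \<subseteq> S0" using q(1) by blast
    fix p and e :: real assume "p \<in> S0" "e > 0"
    then have "L (fst p) \<in> X" by (auto simp: S0_def)
    then obtain c where c: "c \<in> C" "nrm V (L (fst p) \<ominus>\<^bsub>V\<^esub> c) < e" using C(3) \<open>e > 0\<close> by blast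
    then have "N (fst p - fst (q c)) < e" using presents_dist[OF P, of "fst p" "fst (q c)"] q(2) by simp
    then show "\<exists>r\<in>q ` C. (N \<circ> fst) (p - r) < e" using c(1) by (intro bexI[of _ "q c"]) simp_all
  qed
  then have "separable_partial_isometry N N S0" using S0 by (auto simp: separable_partial_isometry_def)
  then obtain S where S: "partial_isometry N N S" "S0 \<subseteq> S" "Domain S = UNIV" "Range S = UNIV"
    using back_and_forth[OF CH I I N sat N sat, of S0] by blast
  obtain F where F: "linear_isometry V (subspace_of (L ` Range S) V) F" "\<And>a b. (a, b) \<in> S \<Longrightarrow> F (L a) = L b"
    using induced_isometry[OF P P S(1,3)] by blast
  have "linear_isometry V V F" using F(1) S(4) presents_range[OF P] by simp
  moreover have "F x = T x" if x: "x \<in> X" for x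
  proof -
    obtain a b where ab: "x = L a" "T x = L b"
      using x XD(1) YD(1) T_in presents_surj[OF P] by (metis subsetD)
    then have "(a, b) \<in> S" using S(2) x by (auto simp: S0_def)
    then show ?thesis using F(2) ab by simp
  qed
  ultimately show "\<exists>F. linear_isometry V V F \<and> (\<forall>x\<in>X. F x = T x)" by blast
qed

section \<open>Universality and homogeneity give saturation\<close>

lemma closed_span_separable:
  fixes N :: "'a::real_vector \<Rightarrow> real" and x :: "nat \<Rightarrow> 'a"
  assumes P: "presents N L V"
  obtains X where "closed_subspace X V" "separable_space (norm_topology (subspace_of X V))"
    "\<And>n. L (x n) \<in> X"
proof -
  interpret V: normed_space V by (rule presents_normed_space[OF P])
  note N = presents_seminorm[OF P]
  define A where "A = {y. \<forall>e>0. \<exists>z\<in>span (range x). N (y - z) < e}"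
  have A_iff: "y \<in> A \<longleftrightarrow> (\<forall>e>0. \<exists>z\<in>span (range x). N (y - z) < e)" for y by (simp add: A_def)
  have span_A: "span (range x) \<subseteq> A"
    unfolding A_iff subset_iff by (metis diff_self seminorm_zero[OF N])
  have add: "y + y' \<in> A" if "y \<in> A" "y' \<in> A" for y y'
    unfolding A_iff
  proof (intro allI impI)
    fix e :: real assume "e > 0"
    then have e2: "e / 2 > 0" by simp
    obtain z z' where z: "z \<in> span (range x)" "N (y - z) < e / 2"
        "z' \<in> span (range x)" "N (y' - z') < e / 2"
      using \<open>y \<in> A\<close>[unfolded A_iff, rule_format, OF e2]
        \<open>y' \<in> A\<close>[unfolded A_iff, rule_format, OF e2] by blast
    have eq: "y + y' - (z + z') = (y - z) + (y' - z')" by simp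
    have "N (y + y' - (z + z')) < e"
      unfolding eq using seminorm_triangle[OF N, of "y - z" "y' - z'"] z by simp
    then show "\<exists>z\<in>span (range x). N (y + y' - z) < e" using z span_add by blast
  qed
  have scale: "r *\<^sub>R y \<in> A" if "y \<in> A" for r y
    unfolding A_iff
  proof (intro allI impI)
    fix e :: real assume "e > 0"
    then have "e / (\<bar>r\<bar> + 1) > 0" by (simp add: add_nonneg_pos)
    then obtain z where z: "z \<in> span (range x)" "N (y - z) < e / (\<bar>r\<bar> + 1)"
      using \<open>y \<in> A\<close> unfolding A_iff by blast
    have "N (r *\<^sub>R y - r *\<^sub>R z) = \<bar>r\<bar> * N (y - z)"
      by (metis scaleR_right_diff_distrib seminorm_scale[OF N])
    also have "\<dots> \<le> (\<bar>r\<bar> + 1) * N (y - z)"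
      using seminorm_nonneg[OF N] by (intro mult_right_mono) auto
    also have "\<dots> < e" using z(2) by (simp add: pos_less_divide_eq mult.commute)
    finally show "\<exists>z\<in>span (range x). N (r *\<^sub>R y - z) < e" using z(1) span_scale by blast
  qed
  have sub: "submodule (L ` A) real_ring V"
  proof (rule V.submodule_if_closed)
    show "L ` A \<subseteq> carrier V" using presents_in[OF P] by blast
    show "L ` A \<noteq> {}" using span_A span_zero by blast
    show "v \<oplus>\<^bsub>V\<^esub> w \<in> L ` A" if "v \<in> L ` A" "w \<in> L ` A" for v w
      using that by (auto simp: presents_add[OF P, symmetric] intro!: imageI add)
    show "r \<odot>\<^bsub>V\<^esub> v \<in> L ` A" if "v \<in> L ` A" for r v
      using that by (auto simp: presents_scale[OF P, symmetric] intro!: imageI scale)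
  qed
  have "closedin (norm_topology V) (L ` A)"
    unfolding V.closedin_iff
  proof (intro conjI ballI impI)
    show "L ` A \<subseteq> carrier V" using presents_in[OF P] by blast
    fix v assume "v \<in> carrier V" and lim: "\<forall>e>0. \<exists>w\<in>L ` A. nrm V (v \<ominus>\<^bsub>V\<^esub> w) < e"
    obtain y where y: "v = L y" by (rule presents_surj[OF P \<open>v \<in> carrier V\<close>])
    have "\<exists>z\<in>span (range x). N (y - z) < e" if "e > 0" for e
    proof -
      obtain y' where y': "y' \<in> A" "N (y - y') < e / 2"
        using lim[rule_format, of "e / 2"] \<open>e > 0\<close> by (auto simp: y presents_dist[OF P])
      obtain z where z: "z \<in> span (range x)" "N (y' - z) < e / 2"
        using y'(1) \<open>e > 0\<close> unfolding A_iff by (meson half_gt_zero)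
      then show ?thesis using seminorm_dist_triangle[OF N, of y z y'] y'(2) by (intro bexI[of _ z]) simp_all
    qed
    then show "v \<in> L ` A" unfolding y A_iff by (simp add: A_def)
  qed
  then have closed: "closed_subspace (L ` A) V" using sub by (simp add: closed_subspace_def)
  obtain Q where Q: "separably_dense N Q (span (range x))" by (rule countable_span_separable[OF N])
  have "\<exists>C. countable C \<and> C \<subseteq> L ` A \<and> (\<forall>v\<in>L ` A. \<forall>e>0. \<exists>c\<in>C. nrm V (v \<ominus>\<^bsub>V\<^esub> c) < e)"
  proof (intro exI[of _ "L ` Q"] conjI ballI allI impI)
    show "countable (L ` Q)" using Q by (simp add: separably_dense_def)
    show "L ` Q \<subseteq> L ` A" using Q span_A by (auto simp: separably_dense_def)
    fix v and e :: real assume "v \<in> L ` A" "e > 0"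
    then obtain y where y: "v = L y" "y \<in> A" by blast
    obtain z where z: "z \<in> span (range x)" "N (y - z) < e / 2"
      using y(2) \<open>e > 0\<close> unfolding A_iff by (meson half_gt_zero)
    obtain q where q: "q \<in> Q" "N (z - q) < e / 2"
      using Q z(1) \<open>e > 0\<close> unfolding separably_dense_def by (meson half_gt_zero)
    have "N (y - q) < e" using seminorm_dist_triangle[OF N, of y q z] z q by simp
    then show "\<exists>c\<in>L ` Q. nrm V (v \<ominus>\<^bsub>V\<^esub> c) < e"
      using q(1) by (intro bexI[of _ "L q"]) (simp_all add: y(1) presents_dist[OF P])
  qed
  then have "separable_space (norm_topology (subspace_of (L ` A) V))"
    by (rule iffD2[OF V.separable_subspace_iff[OF sub]])
  moreover have "L (x n) \<in> L ` A" for n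
    using subsetD[OF span_A span_base[of "x n" "range x"]] by simp
  ultimately show ?thesis by (intro that[OF closed])
qed

lemma linear_isometry_restrict:
  assumes G: "linear_isometry V (subspace_of Z V) G" and X: "X \<subseteq> carrier V"
  shows "linear_isometry (subspace_of X V) (subspace_of (G ` X) V) G"
  unfolding linear_isometry_def
proof (intro conjI)
  show "bij_betw G (carrier (subspace_of X V)) (carrier (subspace_of (G ` X) V))"
    using G X by (auto simp: linear_isometry_def bij_betw_def intro: inj_on_subset)
qed (use G X in \<open>simp_all add: linear_isometry_def subset_iff\<close>)

lemma separable_isometric_image:
  assumes V: "normed_space V" and X: "closed_subspace X V" and Y: "closed_subspace Y V"
    and G: "linear_isometry (subspace_of X V) (subspace_of Y V) G"
    and sep: "separable_space (norm_topology (subspace_of X V))"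
  shows "separable_space (norm_topology (subspace_of Y V))"
proof -
  interpret V: normed_space V by (rule V)
  note sX = V.closed_subspaceD(6)[OF X] and sY = V.closed_subspaceD(6)[OF Y]
  have im: "Y = G ` X" using G by (simp add: linear_isometry_def bij_betw_def)
  have diff: "nrm V (G x \<ominus>\<^bsub>V\<^esub> G y) = nrm V (x \<ominus>\<^bsub>V\<^esub> y)" if "x \<in> X" "y \<in> X" for x y
  proof -
    have "G y \<in> Y" using that im by blast
    then show ?thesis
      using linear_isometry_diff(2)[OF V.normed_space_subspace[OF sX] V.normed_space_subspace[OF sY] G, of x y]
        that by (simp add: V.minus_subspace[OF sX] V.minus_subspace[OF sY])
  qed
  obtain C where C: "countable C" "C \<subseteq> X" "\<And>x e. x \<in> X \<Longrightarrow> e > 0 \<Longrightarrow> \<exists>c\<in>C. nrm V (x \<ominus>\<^bsub>V\<^esub> c) < e"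
    using sep V.separable_subspace_iff[OF sX] by blast
  show ?thesis
    unfolding V.separable_subspace_iff[OF sY]
  proof (intro exI[of _ "G ` C"] conjI ballI allI impI)
    show "countable (G ` C)" "G ` C \<subseteq> Y" using C(1,2) im by auto
    fix y and e :: real assume "y \<in> Y" "e > 0"
    then obtain x where x: "x \<in> X" "y = G x" using im by blast
    obtain c where "c \<in> C" "nrm V (x \<ominus>\<^bsub>V\<^esub> c) < e" using C(3)[OF x(1) \<open>e > 0\<close>] by blast
    then show "\<exists>d\<in>G ` C. nrm V (y \<ominus>\<^bsub>V\<^esub> d) < e"
      using diff[OF x(1), of c] x(2) C(2) by (intro bexI[of _ "G c"]) auto
  qed
qed

text \<open>
  To realize a one-point extension \<open>M\<close> in \<open>V\<close>, embed it into \<open>V\<close> anyhow and then move it into place.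
  An embedding exists since \<open>V\<close> contains the space \<open>U\<close> built from a saturated seminorm, and \<open>U\<close> absorbs
  \<open>M\<close>; in this way the spaces to be embedded never have to be completed. The embedding carries the
  closed span \<open>X\<close> of the given points to another separable subspace, and homogeneity extends this
  isometry to an automorphism \<open>F\<close> of \<open>V\<close>. The point sought is the preimage under \<open>F\<close> of the image of the
  new point.
\<close>

lemma universal_homogeneous_saturated:
  fixes N :: "'a::real_vector \<Rightarrow> real"
  assumes CH: "ctwo ^c natLeq =o cardSuc natLeq" and I: "(UNIV :: 'a set) \<lesssim> (UNIV :: real set)"
    and P: "presents N L V" and V: "universal_homogeneous V"
  shows "one_point_saturated N"
  unfolding one_point_saturated_def
proof (intro allI impI, elim conjE)
  fix x :: "nat \<Rightarrow> 'a" and M :: "'a \<times> real \<Rightarrow> real"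
  assume M: "seminorm M" and MN: "\<forall>y. M (y, 0) = N y"
  interpret V: normed_space V by (rule presents_normed_space[OF P])
  note N = presents_seminorm[OF P]
  obtain K :: "(real \<Rightarrow>\<^sub>0 real) \<Rightarrow> real" where K: "seminorm K" "one_point_saturated K"
    by (rule exists_one_point_saturated[OF CH])
  obtain LU and U :: "real normed_space" where U: "presents K LU U"
    by (rule exists_presented[OF K(1) poly_mapping_lepoll_real])
  have "density U \<le>o aleph1"
    using saturated_density[OF CH poly_mapping_lepoll_real U K(2)] by (rule ordIso_imp_ordLeq)
  then have "isometric_to_subspace U V"
    using V saturated_banach[OF U K(2)] by (simp add: universal_homogeneous_def universal_aleph1_def)
  then obtain Y h where Y: "closed_subspace Y V" and h: "linear_isometry U (subspace_of Y V) h"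
    by (auto simp: isometric_to_subspace_def linearly_isometric_def)
  have h_in: "h (LU b) \<in> carrier V" for b
    using h V.closed_subspaceD(1)[OF Y] presents_in[OF U]
    by (auto simp: linear_isometry_def bij_betw_def)
  have h_add: "h (LU (b + b')) = h (LU b) \<oplus>\<^bsub>V\<^esub> h (LU b')" for b b'
    using h presents_in[OF U] by (simp add: linear_isometry_def presents_add[OF U])
  have h_scale: "h (LU (r *\<^sub>R b)) = r \<odot>\<^bsub>V\<^esub> h (LU b)" for r b
    using h presents_in[OF U] by (simp add: linear_isometry_def presents_scale[OF U])
  have h_nrm: "nrm V (h (LU b)) = K b" for b
    using h presents_in[OF U] by (simp add: linear_isometry_def presents_nrm[OF U])
  obtain S where S: "partial_isometry M K S" "Domain S = UNIV"
    by (rule universality_by_forth[OF CH lepoll_real_times[OF I lepoll_refl] M K])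
  have subS: "subspace S" using S(1) by (simp add: partial_isometry_def)
  \<comment> \<open>the composite embedding of the one-point extension into \<open>V\<close> through \<open>U\<close>, as a relation\<close>
  define R where "R p c \<longleftrightarrow> (\<exists>b. (p, b) \<in> S \<and> h (LU b) = L c)" for p c
  have R_add: "R (p + p') (c + c')" if "R p c" "R p' c'" for p p' c c'
  proof -
    obtain b b' where b: "(p, b) \<in> S" "h (LU b) = L c" "(p', b') \<in> S" "h (LU b') = L c'"
      using \<open>R p c\<close> \<open>R p' c'\<close> by (auto simp: R_def)
    have "(p + p', b + b') \<in> S" using subspace_add[OF subS b(1,3)] by simp
    moreover have "h (LU (b + b')) = L (c + c')" by (simp add: h_add b presents_add[OF P])
    ultimately show ?thesis unfolding R_def by blast
  qed
  have R_scale: "R (r *\<^sub>R p) (r *\<^sub>R c)" if "R p c" for r p c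
  proof -
    obtain b where b: "(p, b) \<in> S" "h (LU b) = L c" using \<open>R p c\<close> by (auto simp: R_def)
    have "(r *\<^sub>R p, r *\<^sub>R b) \<in> S" using subspace_scale[OF subS b(1), of r] by simp
    moreover have "h (LU (r *\<^sub>R b)) = L (r *\<^sub>R c)" by (simp add: h_scale b presents_scale[OF P])
    ultimately show ?thesis unfolding R_def by blast
  qed
  have R_iso: "M p = N c" if "R p c" for p c
  proof -
    obtain b where b: "(p, b) \<in> S" "h (LU b) = L c" using \<open>R p c\<close> by (auto simp: R_def)
    have "M p = K b" by (rule partial_isometry_eq[OF S(1) b(1)])
    also have "\<dots> = nrm V (L c)" using h_nrm[of b] b(2) by simp
    finally show ?thesis by (simp add: presents_nrm[OF P])
  qed
  have R_total: "\<exists>c. R p c" for p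
  proof -
    obtain b where b: "(p, b) \<in> S" using S(2) by blast
    obtain c where "h (LU b) = L c" by (rule presents_surj[OF P h_in])
    then show ?thesis using b unfolding R_def by blast
  qed
  \<comment> \<open>its restriction to the base space, a second embedding of \<open>V\<close> into itself\<close>
  define R0 where "R0 = {(y, c). R (y, 0) c}"
  have "subspace R0"
  proof (rule subspaceI)
    obtain c where "R 0 c" using R_total by blast
    from R_scale[OF this, of 0] show "0 \<in> R0" by (simp add: R0_def zero_prod_def)
    show "p + q \<in> R0" if "p \<in> R0" "q \<in> R0" for p q
      using R_add[of "(fst p, 0)" "snd p" "(fst q, 0)" "snd q"] that by (simp add: R0_def case_prod_beta)
    show "r *\<^sub>R p \<in> R0" if "p \<in> R0" for r p
      using R_scale[of "(fst p, 0)" "snd p" r] that by (simp add: R0_def case_prod_beta)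
  qed
  moreover have "N y = N c" if "(y, c) \<in> R0" for y c
    using R_iso[of "(y, 0)" c] that MN by (simp add: R0_def)
  ultimately have R0: "partial_isometry N N R0" by (auto simp: partial_isometry_def)
  have R0_total: "Domain R0 = UNIV" using R_total by (auto simp: R0_def)
  obtain G where G: "linear_isometry V (subspace_of (L ` Range R0) V) G"
      "\<And>y c. (y, c) \<in> R0 \<Longrightarrow> G (L y) = L c"
    by (rule induced_isometry[OF P P R0 R0_total]) (rule that; assumption)
  obtain X where X: "closed_subspace X V" "separable_space (norm_topology (subspace_of X V))"
      "\<And>n. L (x n) \<in> X"
    by (rule closed_span_separable[OF P, of x]) (rule that; assumption)
  have XV: "X \<subseteq> carrier V" by (rule V.closed_subspaceD(1)[OF X(1)])
  have banach: "banach_space V" using V by (simp add: universal_homogeneous_def)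
  have GX: "linear_isometry (subspace_of X V) (subspace_of (G ` X) V) G"
    by (rule linear_isometry_restrict[OF G(1) XV])
  have "G ` X \<subseteq> carrier V"
  proof -
    have "G ` carrier V = L ` Range R0" using G(1) by (simp add: linear_isometry_def bij_betw_def)
    moreover have "L ` Range R0 \<subseteq> carrier V" using presents_in[OF P] by (auto simp only: image_subset_iff)
    ultimately show ?thesis using image_mono[OF XV, of G] by simp
  qed
  then have closed: "closed_subspace (G ` X) V"
    using closed_subspace_isometric_image[OF banach_closed_subspace[OF banach X(1)] V.normed_space_axioms _ GX]
    by blast
  have "separable_space (norm_topology (subspace_of (G ` X) V))"
    by (rule separable_isometric_image[OF V.normed_space_axioms X(1) closed GX X(2)])
  then obtain F where F: "linear_isometry V V F" "\<And>v. v \<in> X \<Longrightarrow> F v = G v"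
    using V X(1,2) closed GX unfolding universal_homogeneous_def extends_separable_isometries_def by metis
  obtain w where w: "R (0, 1) w" using R_total by blast
  have "L w \<in> F ` carrier V"
    using F(1) presents_in[OF P, of w] by (simp add: linear_isometry_def bij_betw_def)
  then obtain u where u: "u \<in> carrier V" "F u = L w" by force
  obtain v where v: "u = L v" by (rule presents_surj[OF P u(1)])
  have "N (x n + v) = M (x n, 1)" for n
  proof -
    obtain c where c: "R (x n, 0) c" using R_total by blast
    have Fx: "F (L (x n)) = L c" using F(2)[OF X(3)] G(2)[of "x n" c] c by (simp add: R0_def)
    have Fv: "F (L v) = L w" using u(2) v by simp
    have F_add: "F (L (x n) \<oplus>\<^bsub>V\<^esub> L v) = L c \<oplus>\<^bsub>V\<^esub> L w"
      using F(1) presents_in[OF P] by (simp add: linear_isometry_def Fx Fv)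
    have "L (x n) \<oplus>\<^bsub>V\<^esub> L v \<in> carrier V" by (simp add: presents_in[OF P])
    then have F_nrm: "nrm V (F (L (x n) \<oplus>\<^bsub>V\<^esub> L v)) = nrm V (L (x n) \<oplus>\<^bsub>V\<^esub> L v)"
      using F(1) unfolding linear_isometry_def by blast
    have "N (x n + v) = nrm V (L (x n) \<oplus>\<^bsub>V\<^esub> L v)"
      by (simp add: presents_nrm[OF P, symmetric] presents_add[OF P])
    also have "\<dots> = nrm V (L c \<oplus>\<^bsub>V\<^esub> L w)" using F_nrm F_add by simp
    also have "\<dots> = N (c + w)" by (simp add: presents_nrm[OF P, symmetric] presents_add[OF P])
    also have "\<dots> = M (x n, 1)" using R_iso[OF R_add[OF c w]] by simp
    finally show ?thesis .
  qed
  then show "\<exists>v. \<forall>n. N (x n + v) = M (x n, 1)" by blast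
qed

lemma universal_homogeneous_presented:
  assumes CH: "ctwo ^c natLeq =o cardSuc natLeq" and V: "universal_homogeneous V"
  obtains N :: "(real \<Rightarrow>\<^sub>0 real) \<Rightarrow> real" and L where "presents N L V" "one_point_saturated N"
proof -
  have "normed_space V" "density V \<le>o aleph1"
    using V by (simp_all add: universal_homogeneous_def banach_space_def ordIso_imp_ordLeq)
  from presented_by_free_space[OF CH this]
  obtain N :: "(real \<Rightarrow>\<^sub>0 real) \<Rightarrow> real" and L where P: "presents N L V" .
  with universal_homogeneous_saturated[OF CH poly_mapping_lepoll_real P V] show ?thesis
    using that by blast
qed

section \<open>Existence, universality and uniqueness\<close>

theorem theorem7p5:
  assumes CH: "ctwo ^c natLeq =o cardSuc natLeq"
  shows "(\<exists>V :: real normed_space. universal_homogeneous V) \<and>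
         (\<forall>V :: 'v normed_space. universal_homogeneous V \<longrightarrow> universal_aleph1 TYPE('x) V) \<and>
         (\<forall>(V :: 'v normed_space) (W :: 'w normed_space).
            universal_homogeneous V \<and> universal_homogeneous W \<longrightarrow> linearly_isometric V W)"
proof (intro conjI allI impI)
  obtain N :: "(real \<Rightarrow>\<^sub>0 real) \<Rightarrow> real" where N: "seminorm N" "one_point_saturated N"
    by (rule exists_one_point_saturated[OF CH])
  obtain L and V :: "real normed_space" where P: "presents N L V"
    by (rule exists_presented[OF N(1) poly_mapping_lepoll_real])
  have "universal_homogeneous V"
    unfolding universal_homogeneous_def
    using saturated_banach[OF P N(2)] saturated_density[OF CH poly_mapping_lepoll_real P N(2)]
      saturated_universal[OF CH P N(2)] saturated_extends_isometries[OF CH poly_mapping_lepoll_real P N(2)]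
    by blast
  then show "\<exists>V :: real normed_space. universal_homogeneous V" by blast
next
  fix V :: "'v normed_space" assume "universal_homogeneous V"
  from universal_homogeneous_presented[OF CH this]
  obtain N :: "(real \<Rightarrow>\<^sub>0 real) \<Rightarrow> real" and L where "presents N L V" "one_point_saturated N" .
  then show "universal_aleph1 TYPE('x) V" by (rule saturated_universal[OF CH])
next
  fix V :: "'v normed_space" and W :: "'w normed_space"
  assume "universal_homogeneous V \<and> universal_homogeneous W"
  then have V: "universal_homogeneous V" and W: "universal_homogeneous W" by simp_all
  from universal_homogeneous_presented[OF CH V]
  obtain N :: "(real \<Rightarrow>\<^sub>0 real) \<Rightarrow> real" and L where P: "presents N L V" "one_point_saturated N" .
  from universal_homogeneous_presented[OF CH W]
  obtain M :: "(real \<Rightarrow>\<^sub>0 real) \<Rightarrow> real" and K where Q: "presents M K W" "one_point_saturated M" .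
  have N: "seminorm N" and M: "seminorm M" using P Q presents_seminorm by blast+
  obtain S where S: "partial_isometry N M S" "Domain S = UNIV" "Range S = UNIV"
    by (rule back_and_forth[OF CH poly_mapping_lepoll_real poly_mapping_lepoll_real N P(2) M Q(2)
          separable_partial_isometry_zero[OF N M]]) (rule that; assumption)
  obtain G where "linear_isometry V (subspace_of (K ` Range S) W) G"
    by (rule induced_isometry[OF P(1) Q(1) S(1,2)])
  then have "linear_isometry V W G" using S(3) presents_range[OF Q(1)] by simp
  then show "linearly_isometric V W" by (auto simp: linearly_isometric_def)
qed

end
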